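(* Let $n\ge1$ and let $w\in\{0,1\}^n$ be the canonical representation of a binary unlabelled necklace. For any positive integer $m \le n$, the number $RankEN(w,m)$ of binary unlabelled necklaces of length $m$ that enclose $w$ and whose canonical representation is smaller than $w$ can be computed in $O(n^6\log n)$ time.
   Context: Alphabet $\{0,1\}$ with $0<1$; words of equal length compared lexicographically, and for different lengths $v<u$ iff $v^{|u|}<u^{|v|}$ lexicographically or these are equal and $|v|<|u|$. A necklace is an equivalence class of words under rotation; its canonical representation is its lexicographically smallest element. $S$ swaps $0$ and $1$ symbolwise. A binary unlabelled necklace is an equivalence class of words under rotation and $S$, with canonical representation its lexicographically smallest element. A non-symmetric unlabelled necklace consists of two distinct necklaces $N,S(N)$; it encloses $w$ if one of their canonical representations is smaller than $w$ and the other is larger than $w$. *)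

theory Defs
  imports Complex_Main "HOL-Library.Log_Nat" "HOL-Library.Landau_Symbols"
begin

text \<open>
  The symbols 0 and 1 are represented by \<^term>\<open>False\<close> and \<^term>\<open>True\<close>; the library order on
  \<^typ>\<open>bool\<close> gives 0 < 1.
\<close>

type_synonym word = "bool list"

definition words :: "nat \<Rightarrow> word set" where
  "words n = {w. length w = n}"

definition lex_less :: "word \<Rightarrow> word \<Rightarrow> bool" where
  "lex_less v u \<longleftrightarrow> (v, u) \<in> lexord {(a, b). a < b}"

definition word_power :: "word \<Rightarrow> nat \<Rightarrow> word" where
  "word_power v k = concat (replicate k v)"

text \<open>
  On words of equal length this is the plain lexicographic order, since then
  \<^term>\<open>word_power v (length u)\<close> and \<^term>\<open>word_power u (length v)\<close> first differ inside the first copy.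
\<close>

definition word_less :: "word \<Rightarrow> word \<Rightarrow> bool" where
  "word_less v u \<longleftrightarrow>
     (if length v = length u then lex_less v u
      else lex_less (word_power v (length u)) (word_power u (length v)) \<or>
           (word_power v (length u) = word_power u (length v) \<and> length v < length u))"

definition canon :: "word set \<Rightarrow> word" where
  "canon X = (THE v. v \<in> X \<and> (\<forall>u\<in>X. u \<noteq> v \<longrightarrow> word_less v u))"

definition S :: "word \<Rightarrow> word" where
  "S w = map Not w"

definition rot_rel :: "(word \<times> word) set" where
  "rot_rel = {(u, v). \<exists>k. v = rotate k u}"

definition unl_rel :: "(word \<times> word) set" where
  "unl_rel = {(u, v). \<exists>k. v = rotate k u \<or> v = rotate k (S u)}"

definition necklaces :: "nat \<Rightarrow> word set set" where
  "necklaces m = words m // rot_rel"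

definition unlabelled_necklaces :: "nat \<Rightarrow> word set set" where
  "unlabelled_necklaces m = words m // unl_rel"

lemma rot_rel_refl: "(u, u) \<in> rot_rel"
  by (auto simp: rot_rel_def intro!: exI[of _ 0])

lemma rot_rel_sym:
  assumes "(u, v) \<in> rot_rel"
  shows "(v, u) \<in> rot_rel"
proof -
  obtain k where k: "v = rotate k u" using assms unfolding rot_rel_def by blast
  have "u = rotate (length u - k mod length u) v"
  proof (cases "u = []")
    case False
    then have less: "k mod length u < length u" by simp
    have "v = rotate (k mod length u) u" unfolding k by (rule rotate_conv_mod)
    then have "rotate (length u - k mod length u) v
        = rotate (length u - k mod length u + k mod length u) u"
      by (simp only: rotate_rotate)
    also have "\<dots> = u" using less by (simp del: rotate_Suc)
    finally show ?thesis by (rule sym)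
  qed (use k in simp)
  then show ?thesis unfolding rot_rel_def by blast
qed

lemma rot_rel_trans: "(u, v) \<in> rot_rel \<Longrightarrow> (v, w) \<in> rot_rel \<Longrightarrow> (u, w) \<in> rot_rel"
  unfolding rot_rel_def by (auto simp only: mem_Collect_eq prod.case rotate_rotate)

lemma equiv_rot_rel: "equiv UNIV rot_rel"
  by (rule equivI) (auto intro!: refl_onI symI transI intro: rot_rel_refl rot_rel_sym
      dest: rot_rel_trans)

lemma S_S [simp]: "S (S w) = w"
  by (induction w) (simp_all add: S_def)

lemma rot_rel_S: "(u, v) \<in> rot_rel \<Longrightarrow> (S u, S v) \<in> rot_rel"
  unfolding rot_rel_def S_def by (auto simp: rotate_map)

lemma unl_rel_iff: "(u, v) \<in> unl_rel \<longleftrightarrow> (u, v) \<in> rot_rel \<or> (S u, v) \<in> rot_rel"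
  unfolding unl_rel_def rot_rel_def by blast

lemma equiv_unl_rel: "equiv UNIV unl_rel"
proof (rule equivI)
  show "refl unl_rel"
    by (rule refl_onI) (simp add: unl_rel_iff rot_rel_refl)
  show "sym unl_rel"
  proof (rule symI)
    fix u v assume "(u, v) \<in> unl_rel"
    then show "(v, u) \<in> unl_rel"
      unfolding unl_rel_iff using rot_rel_sym[of u v] rot_rel_sym[OF rot_rel_S, of "S u" v] by auto
  qed
  show "trans unl_rel"
  proof (rule transI)
    fix u v w assume uv: "(u, v) \<in> unl_rel" and vw: "(v, w) \<in> unl_rel"
    have "(x, S v) \<in> rot_rel" if "(S x, v) \<in> rot_rel" for x
      using rot_rel_S[OF that] by simp
    then show "(u, w) \<in> unl_rel"
      using uv vw rot_rel_S[of u v] rot_rel_trans[of u v w] rot_rel_trans[of "S u" v w]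
        rot_rel_trans[of u "S v" w] rot_rel_trans[of "S u" "S v" w]
      unfolding unl_rel_iff by blast
  qed
qed auto

definition encloses :: "word set \<Rightarrow> word \<Rightarrow> bool" where
  "encloses A w \<longleftrightarrow>
     (\<exists>m. \<exists>N\<in>necklaces m. A = N \<union> S ` N \<and> N \<noteq> S ` N \<and>
        word_less (canon N) w \<and> word_less w (canon (S ` N)))"

definition RankEN :: "word \<Rightarrow> nat \<Rightarrow> nat" where
  "RankEN w m = card {A \<in> unlabelled_necklaces m. encloses A w \<and> word_less (canon A) w}"

text \<open>
  Model of computation: a random access machine with the arithmetic instructions of Aho, Hopcroft
  and Ullman under the logarithmic cost criterion, where handling a number costs its bit length.
  Memory cells hold natural numbers of any size and are addressed by natural numbers; subtraction is
  truncated, and division by 0 gives 0. Programs are written with structured control flow instead of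
  jumps, which changes running times by at most a constant factor.
\<close>

type_synonym memory = "nat \<Rightarrow> nat"

datatype aop = Add | Sub | Mult | Div

datatype aexp =
    Const nat
  | Contents aexp
  | Op aop aexp aexp

datatype com =
    Skip
  | Store aexp aexp
  | Seq com com
  | IfNZ aexp com com
  | WhileNZ aexp com

fun apply_op :: "aop \<Rightarrow> nat \<Rightarrow> nat \<Rightarrow> nat" where
  "apply_op Add x y = x + y"
| "apply_op Sub x y = x - y"
| "apply_op Mult x y = x * y"
| "apply_op Div x y = x div y"

fun aval :: "aexp \<Rightarrow> memory \<Rightarrow> nat" where
  "aval (Const c) s = c"
| "aval (Contents e) s = s (aval e s)"
| "aval (Op f a b) s = apply_op f (aval a s) (aval b s)"

definition bits :: "nat \<Rightarrow> nat" where
  "bits x = max 1 (floorlog 2 x)"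

fun acost :: "aexp \<Rightarrow> memory \<Rightarrow> nat" where
  "acost (Const c) s = bits c"
| "acost (Contents e) s = acost e s + bits (aval e s) + bits (s (aval e s))"
| "acost (Op f a b) s = acost a s + acost b s + bits (aval a s) + bits (aval b s)"

text \<open>\<^term>\<open>exec c s k s'\<close>: started in memory \<open>s\<close>, program \<open>c\<close> halts in memory \<open>s'\<close> at total cost \<open>k\<close>.
  \<^term>\<open>Store a e\<close> writes the value of \<open>e\<close> to the cell whose address is the value of \<open>a\<close>.\<close>

inductive exec :: "com \<Rightarrow> memory \<Rightarrow> nat \<Rightarrow> memory \<Rightarrow> bool" where
  Skip: "exec Skip s 1 s"
| Store: "exec (Store a e) s
     (acost a s + acost e s + bits (aval a s) + bits (aval e s)) (s(aval a s := aval e s))"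
| Seq: "exec c1 s k1 s1 \<Longrightarrow> exec c2 s1 k2 s2 \<Longrightarrow> exec (Seq c1 c2) s (k1 + k2) s2"
| IfTrue: "aval b s \<noteq> 0 \<Longrightarrow> exec c1 s k t \<Longrightarrow>
     exec (IfNZ b c1 c2) s (acost b s + bits (aval b s) + k) t"
| IfFalse: "aval b s = 0 \<Longrightarrow> exec c2 s k t \<Longrightarrow>
     exec (IfNZ b c1 c2) s (acost b s + bits (aval b s) + k) t"
| WhileFalse: "aval b s = 0 \<Longrightarrow> exec (WhileNZ b c) s (acost b s + bits (aval b s)) s"
| WhileTrue: "aval b s \<noteq> 0 \<Longrightarrow> exec c s k1 s1 \<Longrightarrow> exec (WhileNZ b c) s1 k2 s2 \<Longrightarrow>
     exec (WhileNZ b c) s (acost b s + bits (aval b s) + k1 + k2) s2"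

inductive_cases SkipE: "exec Skip s k t"
inductive_cases StoreE: "exec (Store a e) s k t"
inductive_cases SeqE: "exec (Seq c1 c2) s k t"
inductive_cases IfE: "exec (IfNZ b c1 c2) s k t"
inductive_cases WhileE: "exec (WhileNZ b c) s k t"

lemma exec_deterministic:
  "exec c s k t \<Longrightarrow> exec c s k' t' \<Longrightarrow> k' = k \<and> t' = t"
proof (induction arbitrary: k' t' rule: exec.induct)
  case (Skip s)
  then show ?case by (rule SkipE) simp
next
  case (Store a e s)
  then show ?case by (rule StoreE) simp
next
  case (Seq c1 s k1 s1 c2 k2 s2)
  show ?case
  proof (rule SeqE[OF Seq.prems])
    fix l1 t1 l2
    assume k': "k' = l1 + l2" and 1: "exec c1 s l1 t1" and 2: "exec c2 t1 l2 t'"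
    have eq: "l1 = k1" "t1 = s1" using Seq.IH(1)[OF 1] by blast+
    show ?thesis using Seq.IH(2)[OF 2[unfolded eq]] unfolding k' eq by blast
  qed
next
  case (IfTrue b s c1 k t c2)
  show ?case
  proof (rule IfE[OF IfTrue.prems])
    fix l assume k': "k' = acost b s + bits (aval b s) + l" and 1: "exec c1 s l t'"
    show ?thesis using IfTrue.IH[OF 1] unfolding k' by blast
  next
    assume "aval b s = 0"
    then show ?thesis using IfTrue.hyps(1) by contradiction
  qed
next
  case (IfFalse b s c2 k t c1)
  show ?case
  proof (rule IfE[OF IfFalse.prems])
    assume "0 < aval b s"
    then show ?thesis using IfFalse.hyps(1) by linarith
  next
    fix l assume k': "k' = acost b s + bits 0 + l" and 1: "exec c2 s l t'"
    show ?thesis using IfFalse.IH[OF 1] unfolding k' IfFalse.hyps(1) by blast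
  qed
next
  case (WhileFalse b s c)
  from WhileFalse.prems show ?case by (rule WhileE) (use WhileFalse.hyps in auto)
next
  case (WhileTrue b s c k1 s1 k2 s2)
  show ?case
  proof (rule WhileE[OF WhileTrue.prems])
    assume "aval b s = 0"
    then show ?thesis using WhileTrue.hyps(1) by contradiction
  next
    fix l1 t1 l2
    assume k': "k' = acost b s + bits (aval b s) + l1 + l2"
      and 1: "exec c s l1 t1" and 2: "exec (WhileNZ b c) t1 l2 t'"
    have eq: "l1 = k1" "t1 = s1" using WhileTrue.IH(1)[OF 1] by blast+
    show ?thesis using WhileTrue.IH(2)[OF 2[unfolded eq]] unfolding k' eq by blast
  qed
qed

text \<open>The input occupies the cells \<open>0, \<dots>, n + 1\<close>: first \<open>n\<close>, then \<open>m\<close>, then the symbols of \<open>w\<close>.\<close>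

definition input :: "word \<Rightarrow> nat \<Rightarrow> memory" where
  "input w m i =
     (if i = 0 then length w
      else if i = 1 then m
      else if i < length w + 2 then of_bool (w ! (i - 2))
      else 0)"

text \<open>The result is found in cell 0, and \<open>T\<close> bounds the cost in terms of \<open>n = |w|\<close>.\<close>

definition computes_within ::
  "com \<Rightarrow> (word \<Rightarrow> nat \<Rightarrow> bool) \<Rightarrow> (word \<Rightarrow> nat \<Rightarrow> nat) \<Rightarrow> (nat \<Rightarrow> nat) \<Rightarrow> bool" where
  "computes_within p valid f T \<longleftrightarrow>
     (\<forall>w m. valid w m \<longrightarrow> (\<exists>k s. exec p (input w m) k s \<and> s 0 = f w m \<and> k \<le> T (length w)))"

end

theory Submission
  imports Defs
begin

text \<open>
  Let \<open>W = w w w \<dots>\<close> and \<open>n = |w|\<close>. A necklace \<open>N\<close> of length \<open>m\<close> is counted iff all rotations of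
  \<open>S N\<close> exceed \<open>w\<close> and some rotation of \<open>N\<close> is below \<open>w\<close>. So the rank is the number of necklaces of the
  first kind minus the number of those for which moreover all rotations of \<open>N\<close> are at least \<open>w\<close>
  (where for \<open>m < n\<close> equality of the powers counts as smaller).
  By Burnside's lemma, \<open>m\<close> times such a number is the sum over \<open>k = 1, \<dots>, m\<close> of the number of words of
  length \<open>gcd k m\<close> with the respective property.

  Whether all shifts of a periodic text exceed \<open>W\<close> is tested by an automaton that stores how many
  letters of \<open>W\<close> have been matched: a matching letter advances it, a larger one resets it to 0,
  a smaller one makes it fail. As \<open>W\<close> is minimal among its shifts, forgetting the shorter matches
  at a reset loses nothing, and the words of length at most \<open>n\<close> all of whose shifts exceed \<open>W\<close> are
  those that label a closed walk, whose starting state is then unique. The closed walks of the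
  product of the automaton for \<open>u\<close> with the one for \<open>S u\<close> are counted by dynamic programming.

  The state of the first automaton is kept modulo \<open>n\<close>. For \<open>m = n\<close> this adds \<open>n\<close> closed walks without
  a reset, labelled by the rotations of \<open>w\<close>, which account for the necklace of \<open>w\<close> itself.
\<close>

section \<open>Runs of the comparison automaton on periodic sequences\<close>

text \<open>On words of different lengths the order is the lexicographic order of the infinite
  sequences they generate, with length breaking ties (\<open>word_less_iff\<close>). So
  \<open>w\<close> enters through \<open>W\<close> alone, and one automaton serves words of every
  length. Whether a walk is closed depends on its start, so the dynamic programming is repeated for
  each of the \<open>n^2\<close> pairs of starting states. With \<open>m\<close> layers of
  \<open>n^2\<close> entries this makes O(n^5) assignments. Entries count words of length at most
  \<open>n\<close>, hence have O(n) bits, and the logarithmic cost criterion gives O(n^6), which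
  lies within the required bound. Counting walks counts words only because no word closes at two
  starting states; this is the point of the synchronisation of runs. The counted properties depend
  on the generated sequence only. A word fixed by rotation by \<open>k\<close> may therefore be
  replaced by its prefix of length \<open>gcd k m\<close>, and the layers of one table deliver the
  counts for all these lengths at once.\<close>

definition seq_less :: "(nat \<Rightarrow> bool) \<Rightarrow> (nat \<Rightarrow> bool) \<Rightarrow> bool" where
  "seq_less A B \<longleftrightarrow> (\<exists>k. (\<forall>i<k. A i = B i) \<and> \<not> A k \<and> B k)"

definition shift :: "nat \<Rightarrow> (nat \<Rightarrow> bool) \<Rightarrow> nat \<Rightarrow> bool" where
  "shift p A = (\<lambda>i. A (i + p))"

lemma seq_less_irrefl: "\<not> seq_less A A"
  by (auto simp: seq_less_def)

lemma seq_less_trans: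
  assumes "seq_less A B" "seq_less B C"
  shows "seq_less A C"
proof -
  obtain k where k: "\<forall>i<k. A i = B i" "\<not> A k" "B k" using assms(1) by (auto simp: seq_less_def)
  obtain l where l: "\<forall>i<l. B i = C i" "\<not> B l" "C l" using assms(2) by (auto simp: seq_less_def)
  have "k \<noteq> l" using k l by auto
  then have "(\<forall>i<min k l. A i = C i) \<and> \<not> A (min k l) \<and> C (min k l)"
    using k l by (cases "k < l") (auto simp: min_def)
  then show ?thesis unfolding seq_less_def by blast
qed

lemma seq_less_linear: "seq_less A B \<or> A = B \<or> seq_less B A"
proof (cases "A = B")
  case False
  define k where "k = (LEAST i. A i \<noteq> B i)"
  from False have "\<exists>i. A i \<noteq> B i" by auto
  then have "A k \<noteq> B k" unfolding k_def by (rule LeastI_ex)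
  moreover have "\<forall>i<k. A i = B i" unfolding k_def using not_less_Least by blast
  ultimately show ?thesis unfolding seq_less_def by metis
qed simp

lemma seq_less_asym: "seq_less A B \<Longrightarrow> \<not> seq_less B A"
  using seq_less_trans seq_less_irrefl by blast

definition seqw :: "word \<Rightarrow> nat \<Rightarrow> bool" where
  "seqw v t = v ! (t mod length v)"

text \<open>A mismatch resets to 0 in either direction. That a smaller letter means failure is
  recorded apart by \<open>bad\<close>, so trajectories are total. States are unbounded here,
  \<open>W\<close> being infinite.\<close>

definition tstep :: "(nat \<Rightarrow> bool) \<Rightarrow> nat \<Rightarrow> bool \<Rightarrow> nat" where
  "tstep W i c = (if c = W i then Suc i else 0)"

definition bad :: "(nat \<Rightarrow> bool) \<Rightarrow> nat \<Rightarrow> bool \<Rightarrow> bool" where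
  "bad W i c \<longleftrightarrow> W i \<and> \<not> c"

fun traj :: "(nat \<Rightarrow> bool) \<Rightarrow> (nat \<Rightarrow> bool) \<Rightarrow> nat \<Rightarrow> nat \<Rightarrow> nat" where
  "traj W T j 0 = j"
| "traj W T j (Suc t) = tstep W (traj W T j t) (T t)"

definition closed_state :: "(nat \<Rightarrow> bool) \<Rightarrow> (nat \<Rightarrow> bool) \<Rightarrow> nat \<Rightarrow> nat \<Rightarrow> bool" where
  "closed_state W T d j \<longleftrightarrow> traj W T j d = j \<and> (\<forall>t<d. \<not> bad W (traj W T j t) (T t))"

definition minimal :: "(nat \<Rightarrow> bool) \<Rightarrow> bool" where
  "minimal W \<longleftrightarrow> (\<forall>p. \<not> seq_less (shift p W) W)"

lemma traj_add: "traj W T j (t + s) = traj W (shift t T) (traj W T j t) s"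
  by (induction s) (auto simp: shift_def add.commute)

lemma traj_no_reset:
  assumes "\<And>s. s < k \<Longrightarrow> T s = W (j + s)"
  shows "traj W T j k = j + k"
  using assms by (induction k) (auto simp: tstep_def)

text \<open>After a reset the state counts only letters read since, and the reset itself has used up
  one of the \<open>k\<close> letters. Without a reset every letter has matched.\<close>

lemma traj_cases:
  "traj W T j k = j + k \<and> (\<forall>s<k. T s = W (j + s)) \<or> traj W T j k < k"
proof (induction k)
  case (Suc k)
  then show ?case by (auto simp: tstep_def less_Suc_eq)
qed simp

text \<open>A run without reset would end in \<open>j + d\<close>, so a closed run resets. For
  \<open>d \<le> n\<close> only the states below \<open>n\<close> can therefore close.\<close>

lemma closed_less: "closed_state W T d j \<Longrightarrow> 1 \<le> d \<Longrightarrow> j < d"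
  using traj_cases[of W T j d] by (auto simp: closed_state_def)

lemma periodic_mult:
  fixes d :: nat
  assumes "\<forall>t. T (t + d) = T t"
  shows "T (t + k * d) = T t"
proof (induction k)
  case (Suc k)
  have "t + Suc k * d = (t + k * d) + d" by simp
  then show ?case using assms Suc by metis
qed simp

lemma closed_good_step:
  assumes T: "\<forall>t. T (t + d) = T t" and "1 \<le> d" and cl: "closed_state W T d j"
  shows "traj W T j (t + d) = traj W T j t" "\<not> bad W (traj W T j t) (T t)"
proof -
  have *: "shift d T = T" using T by (auto simp: shift_def)
  show A: "traj W T j (t + d) = traj W T j t" for t
    using cl traj_add[of W T j d t] * by (simp add: closed_state_def add.commute)
  have B: "traj W T j (t + k * d) = traj W T j t" "T (t + k * d) = T t" for t k
    using periodic_mult[of "traj W T j" d t k] periodic_mult[of T d t k] A T by blast+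
  have "traj W T j t = traj W T j (t mod d)" "T t = T (t mod d)"
    using B[of "t mod d" "t div d"] by simp_all
  moreover have "t mod d < d" using assms(2) by simp
  ultimately show "\<not> bad W (traj W T j t) (T t)" using cl by (auto simp: closed_state_def)
qed

section \<open>Borders of \<open>W\<close> and synchronisation of runs\<close>

lemma border_le:
  assumes W: "minimal W" and "\<forall>s<x. W (s + k) = W s"
  shows "W x \<Longrightarrow> W (x + k)"
proof (rule ccontr)
  \<comment> \<open>The first difference of \<open>shift k W\<close> and \<open>W\<close> would be
    at \<open>x\<close>, with the smaller letter in the shift.\<close>
  assume "W x" "\<not> W (x + k)"
  then have "seq_less (shift k W) W" using assms(2) unfolding seq_less_def shift_def by blast
  then show False using W by (auto simp: minimal_def)
qed

text \<open>The state of the run \<open>y\<close> is at least that of a run \<open>x\<close> started at 0, and the matched text of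
  \<open>x\<close> is a border of that of \<open>y\<close>; minimality of \<open>W\<close> then forces \<open>x\<close> to reset together with \<open>y\<close>.\<close>

lemma sync_invariant:
  assumes W: "minimal W" and ok: "\<And>t. \<not> bad W (traj W T j t) (T t)"
  shows "traj W T 0 t = traj W T j t \<or>
    (\<exists>k. traj W T j t = traj W T 0 t + k \<and> (\<forall>s<traj W T 0 t. W (s + k) = W s) \<and> traj W T j t = j + t)"
proof (induction t)
  case 0
  then show ?case by auto
next
  case (Suc t)
  show ?case
  proof (cases "traj W T 0 t = traj W T j t")
    case True
    then show ?thesis by simp
  next
    case False
    let ?x = "traj W T 0 t" let ?y = "traj W T j t"
    obtain k where k: "?y = ?x + k" "\<forall>s<?x. W (s + k) = W s" "?y = j + t"
      using Suc False by auto
    show ?thesis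
    proof (cases "T t = W ?y")
      case True
      then show ?thesis using k by (auto simp: tstep_def less_Suc_eq intro: exI[of _ k])
    next
      case False
      then have "T t" "\<not> W ?y" using ok[of t] by (auto simp: bad_def)
      moreover have "\<not> W ?x" using border_le[OF W k(2)] k(1) \<open>\<not> W ?y\<close> by auto
      ultimately show ?thesis by (simp add: tstep_def)
    qed
  qed
qed

text \<open>The last premise says that the run from \<open>j\<close> has reset by time
  \<open>t\<close>. At its first reset the run from 0 is at 0 as well, and from then on both
  continue alike.\<close>

lemma sync:
  assumes W: "minimal W" and ok: "\<And>t. \<not> bad W (traj W T j t) (T t)"
    and "traj W T j t \<noteq> j + t"
  shows "traj W T 0 t = traj W T j t"
  using sync_invariant[OF W ok, of t] assms(3) by auto

section \<open>Closed runs and texts all of whose shifts exceed \<open>W\<close>\<close>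

lemma closed_imp_good:
  assumes W: "minimal W" and T: "\<forall>t. T (t + d) = T t" and d: "1 \<le> d" and cl: "closed_state W T d j"
  shows "seq_less W (shift p T)"
proof -
  define b where "b = traj W T j p"
  have per: "traj W (shift p T) b d = b"
    unfolding b_def using traj_add[of W T j p d] closed_good_step(1)[OF T d cl, of p] by simp
  \<comment> \<open>Without a reset the run would end in \<open>b + d\<close> and not in
    \<open>b\<close>, so some letter differs from \<open>W\<close> continued at \<open>b\<close>.
    The first such letter is not bad, hence larger: the shifted text exceeds
    \<open>shift b W\<close>, which is at least \<open>W\<close>.\<close>
  have "\<exists>k. T (k + p) \<noteq> W (b + k)"
    using traj_no_reset[of d "shift p T" W b] per d by (auto simp: shift_def)
  then obtain k where k: "T (k + p) \<noteq> W (b + k)" "\<forall>i<k. T (i + p) = W (b + i)"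
    using exists_least_iff[of "\<lambda>k. T (k + p) \<noteq> W (b + k)"] by auto
  have "traj W T j (p + k) = b + k"
    using traj_add[of W T j p k] traj_no_reset[of k "shift p T" W b] k(2)
    by (simp add: b_def shift_def)
  then have "\<not> bad W (b + k) (T (p + k))" using closed_good_step(2)[OF T d cl, of "p + k"] by simp
  then have "seq_less (shift b W) (shift p T)"
    using k unfolding seq_less_def shift_def bad_def by (auto simp: add.commute intro!: exI[of _ k])
  then show ?thesis
    using W seq_less_linear[of W "shift b W"] seq_less_trans by (auto simp: minimal_def)
qed

lemma traj_suffix:
  "traj W T 0 t \<le> t \<and> (\<forall>s<traj W T 0 t. T (t - traj W T 0 t + s) = W s)"
proof (induction t)
  case (Suc t)
  then show ?case by (auto simp: tstep_def less_Suc_eq Suc_diff_le)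
qed simp

text \<open>The matched letters followed by a smaller one would exhibit a shift of the text below
  \<open>W\<close>.\<close>

lemma good_not_bad:
  assumes "\<forall>p. seq_less W (shift p T)"
  shows "\<not> bad W (traj W T 0 t) (T t)"
proof
  let ?b = "traj W T 0 t"
  assume "bad W ?b (T t)"
  then have "seq_less (shift (t - ?b) T) W"
    using traj_suffix[of W T t] unfolding seq_less_def shift_def bad_def
    by (auto simp: add.commute intro!: exI[of _ ?b])
  then show False using assms seq_less_asym by blast
qed

text \<open>If the run never reset again, the text from the beginning of the current match on would
  be \<open>W\<close> itself, against strictness.\<close>

lemma good_reset:
  assumes "\<forall>p. seq_less W (shift p T)"
  shows "\<exists>k. traj W T 0 (t + k) \<noteq> traj W T 0 t + k"
proof (rule ccontr)
  assume no: "\<not> ?thesis"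
  let ?b = "traj W T 0 t"
  have eq: "T (t + k) = W (?b + k)" for k
  proof -
    have "traj W T 0 (t + Suc k) = ?b + Suc k" "traj W T 0 (t + k) = ?b + k" using no by blast+
    then show ?thesis by (auto simp: tstep_def split: if_splits)
  qed
  have "shift (t - ?b) T i = W i" for i
  proof (cases "i < ?b")
    case True
    then have "T (t - ?b + i) = W i" using traj_suffix[of W T t] by blast
    then show ?thesis by (simp only: shift_def add.commute)
  next
    case False
    then show ?thesis using eq[of "i - ?b"] traj_suffix[of W T t] by (simp add: shift_def add.commute)
  qed
  then have "shift (t - ?b) T = W" by auto
  then show False using assms seq_less_irrefl by metis
qed

lemma traj_eq_later:
  "traj W T i t = traj W T j t \<Longrightarrow> t \<le> t' \<Longrightarrow> traj W T i t' = traj W T j t'"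
  by (metis le_Suc_ex traj_add)

text \<open>The run from 0 synchronises with its own copy one period later. From the meeting time on
  it has period \<open>d\<close>, so its state at a multiple of \<open>d\<close> closes.\<close>

lemma good_imp_closed:
  assumes W: "minimal W" and T: "\<forall>t. T (t + d) = T t" and d: "1 \<le> d"
    and good: "\<forall>p. seq_less W (shift p T)"
  shows "\<exists>j. closed_state W T d j"
proof -
  have shift_mult: "shift (k * d) T = T" for k
    using periodic_mult[OF T] by (auto simp: shift_def)
  define y where "y = traj W T 0 d"
  have y: "traj W T y t = traj W T 0 (d + t)" for t
    unfolding y_def using traj_add[of W T 0 d t] shift_mult[of 1] by simp
  have ok: "\<not> bad W (traj W T y t) (T t)" for t
    using good_not_bad[OF good, of "d + t"] T[rule_format, of t] y[of t] by (simp only: add.commute[of d t] simp_thms)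
  obtain t where "traj W T y t \<noteq> y + t"
    using good_reset[OF good, of d] y unfolding y_def by auto
  then have "traj W T 0 t = traj W T y t" using sync[OF W ok] by blast
  \<comment> \<open>The meeting time is postponed to a multiple of \<open>d\<close>, where the text
    begins anew.\<close>
  moreover have "t \<le> t * d" using d by simp
  ultimately have "traj W T 0 (t * d) = traj W T y (t * d)" using traj_eq_later by blast
  then have eq: "traj W T 0 (t * d) = traj W T 0 (t * d + d)" using y by (simp add: add.commute)
  have run: "traj W T (traj W T 0 (t * d)) s = traj W T 0 (t * d + s)" for s
    using traj_add[of W T 0 "t * d" s] shift_mult by simp
  have "T (t * d + s) = T s" for s
    using periodic_mult[OF T, of s t] by (simp add: add.commute)
  then have "closed_state W T d (traj W T 0 (t * d))"
    unfolding closed_state_def run using eq good_not_bad[OF good, of "t * d + _"] by auto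
  then show ?thesis by blast
qed

lemma reset_time:
  "traj W T j k \<noteq> j + k \<Longrightarrow> \<exists>q. traj W T j q = 0"
proof (induction k)
  case (Suc k)
  then show ?case by (cases "T k = W (traj W T j k)") (auto simp: tstep_def intro: exI[of _ "Suc k"])
qed simp

text \<open>Viewed from a time \<open>q\<close> at which the run from \<open>x\<close> is at 0, the
  two runs fall under \<open>sync\<close>. They agree from \<open>q + d\<close> on, in particular at
  \<open>(q + d) * d\<close>, where each is back at its own start.\<close>

lemma closed_unique:
  assumes W: "minimal W" and T: "\<forall>t. T (t + d) = T t" and d: "1 \<le> d"
    and x: "closed_state W T d x" and y: "closed_state W T d y"
  shows "x = y"
proof -
  have "traj W T x d \<noteq> x + d" using x d by (simp add: closed_state_def)
  then obtain q where q: "traj W T x q = 0" using reset_time by blast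
  let ?T = "shift q T" and ?y = "traj W T y q"
  have run: "traj W ?T 0 t = traj W T x (q + t)" "traj W ?T ?y t = traj W T y (q + t)" for t
    using traj_add[of W T x q t] traj_add[of W T y q t] q by simp_all
  have ok: "\<not> bad W (traj W ?T ?y t) (?T t)" for t
    using closed_good_step(2)[OF T d y, of "q + t"] run by (simp add: shift_def add.commute)
  have "traj W ?T ?y d \<noteq> ?y + d"
    unfolding run using closed_good_step(1)[OF T d y, of q] d by simp
  from sync[OF W ok this] have "traj W T x (q + d) = traj W T y (q + d)" unfolding run .
  then have "traj W T x ((q + d) * d) = traj W T y ((q + d) * d)"
    by (rule traj_eq_later) (use d in simp)
  moreover have "traj W T z (k * d) = z" if "closed_state W T d z" for z k
    using periodic_mult[of "traj W T z" d 0 k] closed_good_step(1)[OF T d that] by simp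
  ultimately show ?thesis using x y by simp
qed

text \<open>The cardinality is the form that arises when closed walks are summed over all starting
  states.\<close>

theorem card_closed:
  assumes W: "minimal W" and T: "\<forall>t. T (t + d) = T t" and d: "1 \<le> d" "d \<le> n"
  shows "card {j. j < n \<and> closed_state W T d j} = of_bool (\<forall>p. seq_less W (shift p T))"
proof (cases "\<forall>p. seq_less W (shift p T)")
  case True
  then obtain j where j: "closed_state W T d j" using good_imp_closed[OF W T d(1)] by blast
  then have "j < n" using closed_less[of W T d j] d by simp
  then have "{j. j < n \<and> closed_state W T d j} = {j}"
    using closed_unique[OF W T d(1) _ j] j by blast
  then show ?thesis using True by simp
next
  case False
  then have "{j. j < n \<and> closed_state W T d j} = {}" using closed_imp_good[OF W T d(1)] by blast
  then show ?thesis using False by (simp only: card.empty of_bool_def if_False)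
qed

section \<open>Words as periodic sequences\<close>

lemma lex_less_iff:
  assumes "length a = length b"
  shows "lex_less a b \<longleftrightarrow> (\<exists>k<length a. (\<forall>i<k. a ! i = b ! i) \<and> \<not> a ! k \<and> b ! k)"
proof -
  have "take k a = take k b \<longleftrightarrow> (\<forall>i<k. a ! i = b ! i)" if "k < length a" for k
    using that assms by (auto simp: list_eq_iff_nth_eq)
  then show ?thesis
    using assms unfolding lex_less_def lexord_take_index_conv by auto
qed

lemma length_word_power [simp]: "length (word_power v k) = k * length v"
  by (induction k) (auto simp: word_power_def)

lemma nth_word_power: "i < k * length v \<Longrightarrow> word_power v k ! i = seqw v i"
proof (induction k arbitrary: i)
  case (Suc k)
  have eq: "word_power v (Suc k) = v @ word_power v k" by (simp add: word_power_def)
  show ?case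
  proof (cases "i < length v")
    case False
    then have "word_power v k ! (i - length v) = seqw v (i - length v)"
      using Suc by (intro Suc.IH) auto
    then show ?thesis using False by (simp add: eq nth_append seqw_def le_mod_geq)
  qed (simp add: eq nth_append seqw_def)
qed simp

lemma seqw_period: "seqw v (t + k * length v) = seqw v t"
  by (simp add: seqw_def)

lemma seqw_mod_mult: "seqw v (t mod (k * length v)) = seqw v t"
  by (simp add: seqw_def mod_mult2_eq mult.commute[of k])

text \<open>\<open>P\<close> is a common period, so reducing the position of a difference modulo
  \<open>P\<close> gives a difference again.\<close>

lemma seq_less_bounded:
  assumes "\<And>t. A (t mod P) = A t" "\<And>t. B (t mod P) = B t" "0 < P"
  shows "seq_less A B \<longleftrightarrow> (\<exists>k<P. (\<forall>i<k. A i = B i) \<and> \<not> A k \<and> B k)"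
proof
  assume "seq_less A B"
  then obtain k where k: "\<forall>i<k. A i = B i" "\<not> A k" "B k" by (auto simp: seq_less_def)
  have "k < P"
  proof (rule ccontr)
    assume "\<not> k < P"
    then have "k mod P < k" using \<open>0 < P\<close> by (meson mod_less_divisor not_less order.strict_trans2)
    then have "A (k mod P) = B (k mod P)" using k(1) by blast
    then show False using assms(1)[of k] assms(2)[of k] k(2,3) by metis
  qed
  then show "\<exists>k<P. (\<forall>i<k. A i = B i) \<and> \<not> A k \<and> B k" using k by blast
qed (auto simp: seq_less_def)

lemma lex_less_word_power:
  assumes "u \<noteq> []" "v \<noteq> []"
  shows "lex_less (word_power v (length u)) (word_power u (length v)) \<longleftrightarrow> seq_less (seqw v) (seqw u)"
proof -
  let ?P = "length u * length v"
  have "seq_less (seqw v) (seqw u) \<longleftrightarrow>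
      (\<exists>k<?P. (\<forall>i<k. seqw v i = seqw u i) \<and> \<not> seqw v k \<and> seqw u k)"
    using assms seqw_mod_mult[of v _ "length u"] seqw_mod_mult[of u _ "length v"]
    by (intro seq_less_bounded) (simp_all add: mult.commute)
  also have "\<dots> \<longleftrightarrow> lex_less (word_power v (length u)) (word_power u (length v))"
  proof -
    have len: "length (word_power v (length u)) = ?P" "length (word_power u (length v)) = ?P"
      by simp_all
    have nth: "word_power v (length u) ! k = seqw v k" "word_power u (length v) ! k = seqw u k"
      if "k < ?P" for k
      using that by (simp_all add: nth_word_power mult.commute)
    show ?thesis
      unfolding lex_less_iff[OF trans[OF len(1) len(2)[symmetric]]] len(1)
      using nth by (metis (no_types, lifting) order.strict_trans)
  qed
  finally show ?thesis by simp
qed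

lemma word_power_eq_iff:
  assumes "u \<noteq> []" "v \<noteq> []"
  shows "word_power v (length u) = word_power u (length v) \<longleftrightarrow> seqw v = seqw u"
proof -
  let ?P = "length u * length v"
  have "word_power v (length u) = word_power u (length v) \<longleftrightarrow> (\<forall>k<?P. seqw v k = seqw u k)"
    by (simp add: list_eq_iff_nth_eq nth_word_power mult.commute)
  also have "\<dots> \<longleftrightarrow> seqw v = seqw u"
  proof
    assume *: "\<forall>k<?P. seqw v k = seqw u k"
    show "seqw v = seqw u"
    proof
      fix k
      have "k mod ?P < ?P" using assms by simp
      then show "seqw v k = seqw u k"
        using * seqw_mod_mult[of v k "length u"] seqw_mod_mult[of u k "length v"]
        by (metis mult.commute)
    qed
  qed simp
  finally show ?thesis .
qed

lemma lex_less_eq_seq_less: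
  assumes "length u = length v" "v \<noteq> []"
  shows "lex_less v u \<longleftrightarrow> seq_less (seqw v) (seqw u)"
proof -
  have "seq_less (seqw v) (seqw u) \<longleftrightarrow>
      (\<exists>k<length v. (\<forall>i<k. seqw v i = seqw u i) \<and> \<not> seqw v k \<and> seqw u k)"
    using assms by (intro seq_less_bounded) (simp_all add: seqw_def)
  also have "\<dots> \<longleftrightarrow> lex_less v u"
    using assms by (auto simp: lex_less_iff seqw_def intro!: ex_cong1)
  finally show ?thesis by simp
qed

text \<open>The two powers have the common length \<open>length u * length v\<close>, which is a
  period of both sequences, so comparing the powers compares the sequences.\<close>

lemma word_less_iff:
  assumes "u \<noteq> []" "v \<noteq> []"
  shows "word_less v u \<longleftrightarrow>
    seq_less (seqw v) (seqw u) \<or> (seqw v = seqw u \<and> length v < length u)"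
proof (cases "length v = length u")
  case True
  then show ?thesis using assms lex_less_eq_seq_less[of u v] by (simp add: word_less_def)
next
  case False
  then show ?thesis
    by (simp add: word_less_def lex_less_word_power[OF assms] word_power_eq_iff[OF assms])
qed

lemma seqw_inj: "length u = length v \<Longrightarrow> seqw u = seqw v \<Longrightarrow> u = v"
  by (rule nth_equalityI) (simp, metis mod_less seqw_def)

lemma seqw_rotate: "u \<noteq> [] \<Longrightarrow> seqw (rotate p u) = shift p (seqw u)"
  by (auto simp: seqw_def shift_def nth_rotate fun_eq_iff mod_simps add.commute)

lemma seqw_S: "u \<noteq> [] \<Longrightarrow> seqw (S u) t \<longleftrightarrow> \<not> seqw u t"
  by (simp add: seqw_def S_def)

lemma length_S [simp]: "length (S u) = length u"
  by (simp add: S_def)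

lemma S_eq_Nil [simp]: "S u = [] \<longleftrightarrow> u = []"
  by (simp add: S_def)

lemma S_rotate: "S (rotate k u) = rotate k (S u)"
  by (simp add: S_def rotate_map)

section \<open>Words all of whose rotations exceed \<open>w\<close>\<close>

definition good :: "(nat \<Rightarrow> bool) \<Rightarrow> word \<Rightarrow> bool" where
  "good W u \<longleftrightarrow> (\<forall>p. seq_less W (shift p (seqw u)))"

lemma shift_shift: "shift p (shift q A) = shift (p + q) A"
  by (simp add: shift_def add.assoc)

lemma shift_range_seqw:
  assumes "u \<noteq> []"
  shows "(\<forall>q. Q (shift (q + p) (seqw u))) \<longleftrightarrow> (\<forall>q. Q (shift q (seqw u)))"
proof
  assume *: "\<forall>q. Q (shift (q + p) (seqw u))"
  show "\<forall>q. Q (shift q (seqw u))"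
  proof
    fix q
    \<comment> \<open>Congruent to \<open>q - p\<close> modulo the period; the added multiple keeps
      the subtraction from being truncated.\<close>
    let ?q = "q + p * length u - p"
    have "p \<le> p * length u" using assms by (cases u) auto
    then have "?q + p = q + p * length u" by (simp only: le_add_diff_inverse2 trans_le_add2)
    moreover have "shift (q + p * length u) (seqw u) = shift q (seqw u)"
      by (simp add: shift_def add.assoc[symmetric] seqw_period)
    ultimately show "Q (shift q (seqw u))" using * by metis
  qed
qed blast

lemma good_rotate [simp]: "u \<noteq> [] \<Longrightarrow> good W (rotate k u) \<longleftrightarrow> good W u"
proof -
  assume u: "u \<noteq> []"
  show ?thesis
    using shift_range_seqw[OF u, of "seq_less W" k] by (simp only: good_def seqw_rotate[OF u] shift_shift)
qed

section \<open>Canonical representations\<close>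

lemma finite_words: "finite (words m)"
  using finite_lists_length_eq[of "UNIV :: bool set" m] by (simp add: words_def)

text \<open>Distinct words of one positive length generate distinct sequences, so
  \<open>word_less\<close> is a strict linear order on them and the description in
  \<open>canon\<close> has exactly one solution.\<close>

lemma canon_least:
  assumes X: "X \<subseteq> words m" "X \<noteq> {}" and m: "1 \<le> m"
  shows "canon X \<in> X" "u \<in> X \<Longrightarrow> u \<noteq> canon X \<Longrightarrow> word_less (canon X) u"
proof -
  have fin: "finite X" using X finite_words finite_subset by blast
  have ne: "x \<noteq> []" "length x = m" if "x \<in> X" for x using X(1) that m by (auto simp: words_def)
  have less: "word_less x y \<longleftrightarrow> seq_less (seqw x) (seqw y)" if "x \<in> X" "y \<in> X" for x y
    using word_less_iff ne that by auto
  have "\<exists>v\<in>Y. \<forall>u\<in>Y. u \<noteq> v \<longrightarrow> word_less v u" if "finite Y" "Y \<noteq> {}" "Y \<subseteq> X" for Y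
    using that
  proof (induction Y rule: finite_ne_induct)
    case (insert y Y)
    then obtain v where v: "v \<in> Y" "\<forall>u\<in>Y. u \<noteq> v \<longrightarrow> word_less v u" by auto
    have "v \<noteq> y" using v insert by auto
    then have "seqw v \<noteq> seqw y" using seqw_inj ne insert.prems v by auto
    then consider "word_less v y" | "word_less y v"
      using seq_less_linear less insert.prems v by (metis insert_subset subsetD)
    then show ?case
    proof cases
      case 1
      then show ?thesis using v by auto
    next
      case 2
      have "word_less y u" if "u \<in> Y" for u
      proof (cases "u = v")
        case False
        then have "word_less v u" using v that by blast
        then show ?thesis using 2 less seq_less_trans insert.prems that v
          by (meson insert_subset subsetD)
      qed (use 2 in simp)
      then show ?thesis by auto
    qed
  qed simp
  then obtain v where v: "v \<in> X" "\<forall>u\<in>X. u \<noteq> v \<longrightarrow> word_less v u" using fin X by blast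
  have "canon X = v"
    unfolding canon_def
  proof (rule the_equality)
    show "v \<in> X \<and> (\<forall>u\<in>X. u \<noteq> v \<longrightarrow> word_less v u)" using v by (rule conjI)
  next
    fix x assume x: "x \<in> X \<and> (\<forall>u\<in>X. u \<noteq> x \<longrightarrow> word_less x u)"
    show "x = v"
    proof (rule ccontr)
      assume "x \<noteq> v"
      then have "word_less x v" "word_less v x" using x v by auto
      then have "seq_less (seqw x) (seqw v)" "seq_less (seqw v) (seqw x)"
        using less x v(1) by simp_all
      then show False using seq_less_asym by blast
    qed
  qed
  then show "canon X \<in> X" using v(1) by simp
  show "word_less (canon X) u" if "u \<in> X" "u \<noteq> canon X"
    using v(2) that \<open>canon X = v\<close> by metis
qed

text \<open>Rotations of \<open>w\<close> stay in its class, so none is smaller than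
  \<open>w\<close>; rotations of the word are shifts of the sequence.\<close>

lemma canon_unlabelled_minimal:
  assumes "w \<in> canon ` unlabelled_necklaces n" "1 \<le> n"
  shows "length w = n" "minimal (seqw w)"
proof -
  obtain A where A: "A \<in> unlabelled_necklaces n" "w = canon A" using assms by blast
  then obtain x where x: "x \<in> words n" "A = unl_rel `` {x}"
    unfolding unlabelled_necklaces_def by (auto simp: quotient_def)
  have sub: "A \<subseteq> words n" using x by (auto simp: unl_rel_def words_def)
  have "x \<in> A" using x by (auto simp: unl_rel_iff rot_rel_refl)
  then have wA: "w \<in> A" and least: "\<And>u. u \<in> A \<Longrightarrow> u \<noteq> w \<Longrightarrow> word_less w u"
    using canon_least[OF sub _ assms(2)] A(2) by auto
  then show len: "length w = n" using sub by (auto simp: words_def)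
  then have ne: "w \<noteq> []" using assms(2) by auto
  have "\<not> seq_less (shift p (seqw w)) (seqw w)" for p
  proof -
    have "(w, rotate p w) \<in> unl_rel" by (auto simp: unl_rel_def)
    then have "rotate p w \<in> A"
      using wA x(2) equiv_unl_rel by (auto simp: equiv_def dest: transD)
    then have "rotate p w = w \<or> word_less w (rotate p w)" using least by blast
    then have "seqw (rotate p w) = seqw w \<or> seq_less (seqw w) (seqw (rotate p w))"
      using word_less_iff[of "rotate p w" w] ne by auto
    then show ?thesis using seqw_rotate[OF ne] seq_less_asym seq_less_irrefl by metis
  qed
  then show "minimal (seqw w)" by (simp add: minimal_def)
qed

section \<open>Closed walks and dynamic programming\<close>

fun runo :: "(nat \<Rightarrow> bool \<Rightarrow> nat option) \<Rightarrow> nat \<Rightarrow> word \<Rightarrow> nat option" where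
  "runo \<delta> q [] = Some q"
| "runo \<delta> q (c # u) = Option.bind (\<delta> q c) (\<lambda>q'. runo \<delta> q' u)"

definition lower_step :: "bool \<Rightarrow> word \<Rightarrow> nat \<Rightarrow> bool \<Rightarrow> nat option" where
  "lower_step f w i c =
     (if f then (if c = w ! i then Some (Suc i mod length w) else if c then Some 0 else None)
      else Some 0)"

text \<open>A match of all \<open>n\<close> letters fails instead of wrapping round. By
  \<open>closed_bound\<close> no closed run of length at most \<open>n\<close> is lost, and
  rotations of \<open>w\<close> itself do not close.\<close>

definition upper_step :: "word \<Rightarrow> nat \<Rightarrow> bool \<Rightarrow> nat option" where
  "upper_step w j c =
     (if c = w ! j then (if Suc j < length w then Some (Suc j) else None)
      else if c then Some 0 else None)"

text \<open>
  If \<open>f\<close> is false, the first automaton is replaced by one with the single state 0.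
  The second one reads \<open>S u\<close>, so its transitions are those of the complementary letter.
\<close>

fun walks :: "bool \<Rightarrow> word \<Rightarrow> nat \<Rightarrow> nat \<Rightarrow> nat \<Rightarrow> nat \<Rightarrow> nat \<Rightarrow> nat" where
  "walks f w i0 j0 0 i j = of_bool (i = i0 \<and> j = j0)"
| "walks f w i0 j0 (Suc t) i j =
     (if j < length w then
        (1 - of_bool (f \<and> w ! i)) *
          walks f w i0 j0 t (if f then Suc i mod length w else 0) (if w ! j then Suc j else 0) +
        (1 - of_bool (w ! j)) *
          walks f w i0 j0 t (if f \<and> w ! i then Suc i mod length w else 0) (Suc j)
      else 0)"

text \<open>The states are optional so that a failed automaton yields the empty set and one reading
  step needs no case distinction.\<close>

definition walk_words :: "bool \<Rightarrow> word \<Rightarrow> nat \<Rightarrow> nat \<Rightarrow> nat \<Rightarrow> nat option \<Rightarrow> nat option \<Rightarrow> word set" where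
  "walk_words f w i0 j0 t x y =
     {u \<in> words t. Option.bind x (\<lambda>i. runo (lower_step f w) i u) = Some i0 \<and>
        Option.bind y (\<lambda>j. runo (upper_step w) j (S u)) = Some j0}"

lemma words_Suc: "words (Suc t) = (#) False ` words t \<union> (#) True ` words t"
  unfolding words_def by (auto simp: length_Suc_conv image_iff)

lemma walk_words_Suc:
  "card (walk_words f w i0 j0 (Suc t) (Some i) (Some j)) =
     card (walk_words f w i0 j0 t (lower_step f w i False) (upper_step w j True)) +
     card (walk_words f w i0 j0 t (lower_step f w i True) (upper_step w j False))"
proof -
  have "walk_words f w i0 j0 (Suc t) (Some i) (Some j) =
      (#) False ` walk_words f w i0 j0 t (lower_step f w i False) (upper_step w j True) \<union>
      (#) True ` walk_words f w i0 j0 t (lower_step f w i True) (upper_step w j False)"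
    unfolding walk_words_def words_Suc by (auto simp: S_def)
  moreover have "finite (walk_words f w i0 j0 t x y)" for x y
    using finite_words by (simp add: walk_words_def)
  moreover have "(#) False ` X \<inter> (#) True ` Y = {}" for X Y :: "word set" by auto
  ultimately show ?thesis by (simp add: card_Un_disjoint card_image)
qed

lemma walk_words_None [simp]:
  "walk_words f w i0 j0 t None y = {}" "walk_words f w i0 j0 t x None = {}"
  by (auto simp: walk_words_def)

text \<open>The two summands of the recursion belong to the first letters 0 and 1. A vanishing
  factor records a smaller letter in one automaton, the state \<open>length w\<close> a full match
  in the second.\<close>

lemma walks_eq_card:
  assumes "i < length w" "j0 < length w" "j \<le> length w"
  shows "walks f w i0 j0 t i j =
    card (walk_words f w i0 j0 t (Some i) (if j < length w then Some j else None))"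
  using assms
proof (induction t arbitrary: i j)
  case 0
  have "walk_words f w i0 j0 0 (Some i) (Some j) = (if i = i0 \<and> j = j0 then {[]} else {})"
    by (auto simp: walk_words_def words_def S_def)
  then show ?case using 0 by auto
next
  case (Suc t)
  show ?case
  proof (cases "j < length w")
    case True
    have "0 < length w" "Suc i mod length w < length w"
      using Suc.prems mod_less_divisor[of "length w" "Suc i"] by linarith+
    note IH = Suc.IH[OF _ \<open>j0 < length w\<close>]
    show ?thesis
      using True walk_words_Suc[of f w i0 j0 t i j] IH \<open>0 < length w\<close> \<open>Suc i mod length w < length w\<close>
      by (cases f; cases "w ! i"; cases "w ! j") (simp_all add: lower_step_def upper_step_def)
  qed simp
qed

text \<open>Gives the table entries O(n) bits, the source of one factor \<open>n\<close> in the
  running time.\<close>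

lemma walks_le: "walks f w i0 j0 t i j \<le> 2 ^ t"
proof (induction t arbitrary: i j)
  case (Suc t)
  have *: "a * x + b * y \<le> 2 ^ Suc t" if "a \<le> 1" "b \<le> 1" "x \<le> 2 ^ t" "y \<le> 2 ^ t" for a b x y :: nat
    using mult_le_mono[OF that(1,3)] mult_le_mono[OF that(2,4)] by simp
  then show ?case unfolding walks.simps(2) using Suc by (auto intro!: * simp del: power_Suc)
qed simp

section \<open>Runs on words as trajectories\<close>

lemma runo_append_one: "runo \<delta> q (u @ [c]) = Option.bind (runo \<delta> q u) (\<lambda>q'. \<delta> q' c)"
proof (induction u arbitrary: q)
  case Nil
  then show ?case by (cases "\<delta> q c") auto
next
  case (Cons a u)
  then show ?case by (cases "\<delta> q a") auto
qed

lemma traj_cong: "(\<And>s. s < t \<Longrightarrow> T s = T' s) \<Longrightarrow> traj W T j t = traj W T' j t"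
  by (induction t) auto

lemma runo_upper_iff:
  assumes "j < length w"
  shows "runo (upper_step w) j u = Some j' \<longleftrightarrow>
    traj (seqw w) ((!) u) j (length u) = j' \<and>
    (\<forall>t<length u. \<not> bad (seqw w) (traj (seqw w) ((!) u) j t) (u ! t) \<and>
       traj (seqw w) ((!) u) j (Suc t) < length w)"
  using assms
proof (induction u arbitrary: j' rule: rev_induct)
  case Nil
  then show ?case by simp
next
  case (snoc c u)
  let ?W = "seqw w" and ?q = "traj (seqw w) ((!) u) j (length u)"
  have cong: "traj ?W ((!) (u @ [c])) j t = traj ?W ((!) u) j t" if "t \<le> length u" for t
    using that by (intro traj_cong) (simp add: nth_append)
  have nth: "(u @ [c]) ! t = u ! t" if "t < length u" for t using that by (simp add: nth_append)
  have q: "?q < length w" if "\<forall>t<length u. traj ?W ((!) u) j (Suc t) < length w"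
    using that snoc.prems by (cases "length u") auto
  have step: "upper_step w p c = Some j' \<longleftrightarrow> tstep ?W p c = j' \<and> \<not> bad ?W p c \<and> tstep ?W p c < length w"
    if "p < length w" for p
    using that snoc.prems by (auto simp: upper_step_def tstep_def bad_def seqw_def)
  have "runo (upper_step w) j (u @ [c]) = Some j' \<longleftrightarrow>
      (\<forall>t<length u. \<not> bad ?W (traj ?W ((!) u) j t) (u ! t) \<and> traj ?W ((!) u) j (Suc t) < length w) \<and>
      upper_step w ?q c = Some j'"
    unfolding runo_append_one bind_eq_Some_conv snoc.IH[OF snoc.prems] by auto
  also have "\<dots> \<longleftrightarrow>
      (\<forall>t<length u. \<not> bad ?W (traj ?W ((!) u) j t) (u ! t) \<and> traj ?W ((!) u) j (Suc t) < length w) \<and>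
      tstep ?W ?q c = j' \<and> \<not> bad ?W ?q c \<and> tstep ?W ?q c < length w"
    using q step by blast
  finally show ?case
    by (simp add: All_less_Suc cong nth conj_ac)
qed

text \<open>Reduction modulo \<open>n\<close> commutes with the transitions because
  \<open>seqw w\<close> has period \<open>n\<close>, so the trajectory can be left
  unreduced.\<close>

lemma runo_lower_iff:
  assumes "i < length w"
  shows "runo (lower_step True w) i u = Some i' \<longleftrightarrow>
    traj (seqw w) ((!) u) i (length u) mod length w = i' \<and>
    (\<forall>t<length u. \<not> bad (seqw w) (traj (seqw w) ((!) u) i t) (u ! t))"
  using assms
proof (induction u arbitrary: i' rule: rev_induct)
  case Nil
  then show ?case by simp
next
  case (snoc c u)
  let ?W = "seqw w" and ?q = "traj (seqw w) ((!) u) i (length u)"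
  have cong: "traj ?W ((!) (u @ [c])) i t = traj ?W ((!) u) i t" if "t \<le> length u" for t
    using that by (intro traj_cong) (simp add: nth_append)
  have nth: "(u @ [c]) ! t = u ! t" if "t < length u" for t using that by (simp add: nth_append)
  have step: "lower_step True w (p mod length w) c = Some i' \<longleftrightarrow>
      tstep ?W p c mod length w = i' \<and> \<not> bad ?W p c" for p
    by (auto simp: lower_step_def tstep_def bad_def seqw_def mod_Suc_eq)
  have "runo (lower_step True w) i (u @ [c]) = Some i' \<longleftrightarrow>
      (\<forall>t<length u. \<not> bad ?W (traj ?W ((!) u) i t) (u ! t)) \<and>
      lower_step True w (?q mod length w) c = Some i'"
    unfolding runo_append_one bind_eq_Some_conv snoc.IH[OF snoc.prems] by auto
  then show ?case
    unfolding step by (simp add: All_less_Suc cong nth conj_ac)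
qed

lemma runo_lower_trivial:
  assumes "u \<noteq> []"
  shows "runo (lower_step False w) i u = Some 0"
proof -
  have L: "lower_step False w i c = Some 0" for i c by (simp add: lower_step_def)
  have *: "runo (lower_step False w) 0 v = Some 0" for v
  proof (induction v)
    case (Cons c v)
    then show ?case by (simp add: L)
  qed simp
  from assms show ?thesis by (cases u) (simp_all add: L *)
qed

text \<open>Every state on a closed run recurs after \<open>d\<close> letters, so the argument for
  the starting state applies to it too.\<close>

lemma closed_bound:
  assumes T: "\<forall>t. T (t + d) = T t" and d: "1 \<le> d" and cl: "closed_state W T d j"
  shows "traj W T j t < d"
proof -
  have "traj W (shift t T) (traj W T j t) d = traj W T j t"
    using traj_add[of W T j t d] closed_good_step(1)[OF T d cl, of t] by simp
  then show ?thesis using traj_cases[of W "shift t T" "traj W T j t" d] d by auto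
qed

lemma seqw_periodic: "\<forall>t. seqw v (t + length v) = seqw v t"
  by (simp add: seqw_def)

lemma traj_seqw: "t \<le> length v \<Longrightarrow> traj W ((!) v) j t = traj W (seqw v) j t"
  by (rule traj_cong) (simp add: seqw_def)

lemma runo_upper_closed:
  assumes "j < length w" "1 \<le> length v" "length v \<le> length w"
  shows "runo (upper_step w) j v = Some j \<longleftrightarrow> closed_state (seqw w) (seqw v) (length v) j"
proof
  assume "runo (upper_step w) j v = Some j"
  then show "closed_state (seqw w) (seqw v) (length v) j"
    unfolding runo_upper_iff[OF assms(1)] closed_state_def
    using traj_seqw[of _ v "seqw w" j] by (simp add: seqw_def)
next
  assume cl: "closed_state (seqw w) (seqw v) (length v) j"
  have bnd: "traj (seqw w) (seqw v) j t < length w" for t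
    using closed_bound[OF seqw_periodic assms(2) cl, of t] assms(3) by simp
  have eq: "traj (seqw w) ((!) v) j t = traj (seqw w) (seqw v) j t" if "t \<le> length v" for t
    using traj_seqw that .
  show "runo (upper_step w) j v = Some j"
    unfolding runo_upper_iff[OF assms(1)]
  proof (intro conjI allI impI)
    show "traj (seqw w) ((!) v) j (length v) = j" using cl eq by (simp add: closed_state_def)
    fix t assume t: "t < length v"
    then show "\<not> bad (seqw w) (traj (seqw w) ((!) v) j t) (v ! t)"
      using cl eq[of t] by (simp add: closed_state_def seqw_def)
    show "traj (seqw w) ((!) v) j (Suc t) < length w"
      using eq[of "Suc t"] bnd[of "Suc t"] t by (simp only: Suc_le_eq)
  qed
qed

lemma card_upper_closed:
  assumes "minimal (seqw w)" "1 \<le> length v" "length v \<le> length w"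
  shows "card {j. j < length w \<and> runo (upper_step w) j v = Some j} = of_bool (good (seqw w) v)"
proof -
  have "{j. j < length w \<and> runo (upper_step w) j v = Some j} =
      {j. j < length w \<and> closed_state (seqw w) (seqw v) (length v) j}"
    using runo_upper_closed[OF _ assms(2,3)] by blast
  then show ?thesis
    using card_closed[OF assms(1) seqw_periodic assms(2,3)] by (simp only: good_def)
qed

lemma eq_rotate_iff:
  assumes "length u = length w"
  shows "u = rotate i w \<longleftrightarrow> (\<forall>s<length u. u ! s = seqw w (i + s))"
  using assms by (auto simp: list_eq_iff_nth_eq nth_rotate seqw_def)

text \<open>With a reset the final state is below \<open>d\<close>, and reduction modulo
  \<open>n\<close> does not change it. Without one it is \<open>i + d\<close>, which is congruent to
  \<open>i\<close> only for \<open>d = n\<close>; the letters read are then those of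
  \<open>w\<close> from position \<open>i\<close> on.\<close>

lemma runo_lower_closed:
  assumes "i < length w" "1 \<le> length u" "length u \<le> length w"
  shows "runo (lower_step True w) i u = Some i \<longleftrightarrow>
    closed_state (seqw w) (seqw u) (length u) i \<or> length u = length w \<and> u = rotate i w"
proof -
  let ?W = "seqw w" and ?d = "length u" and ?n = "length w"
  have eq: "traj ?W ((!) u) i t = traj ?W (seqw u) i t" if "t \<le> ?d" for t
    using traj_seqw that .
  have letters: "u ! t = seqw u t" if "t < ?d" for t using that by (simp add: seqw_def)
  have runo: "runo (lower_step True w) i u = Some i \<longleftrightarrow>
      traj ?W (seqw u) i ?d mod ?n = i \<and> (\<forall>t<?d. \<not> bad ?W (traj ?W (seqw u) i t) (seqw u t))"
    unfolding runo_lower_iff[OF assms(1)] using eq letters by auto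
  show ?thesis
  proof (cases "traj ?W (seqw u) i ?d < ?d")
    case True
    have "\<not> (?d = ?n \<and> u = rotate i w)"
    proof
      assume "?d = ?n \<and> u = rotate i w"
      then have "\<forall>s<?d. seqw u s = ?W (i + s)" using eq_rotate_iff letters by metis
      then have "traj ?W (seqw u) i ?d = i + ?d" by (intro traj_no_reset) auto
      then show False using True by simp
    qed
    moreover have "traj ?W (seqw u) i ?d mod ?n = traj ?W (seqw u) i ?d" using True assms(3) by simp
    ultimately show ?thesis unfolding runo closed_state_def by auto
  next
    case False
    then have t: "traj ?W (seqw u) i ?d = i + ?d" and eqs: "\<forall>s<?d. seqw u s = ?W (i + s)"
      using traj_cases[of ?W "seqw u" i ?d] by auto
    have nb: "\<not> bad ?W (traj ?W (seqw u) i t) (seqw u t)" if "t < ?d" for t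
    proof -
      have "traj ?W (seqw u) i t = i + t" using eqs that by (intro traj_no_reset) auto
      then show ?thesis using eqs that by (simp add: bad_def)
    qed
    have "(i + ?d) mod ?n = i \<longleftrightarrow> ?d = ?n"
    proof (cases "i + ?d < ?n")
      case False
      then have "(i + ?d) mod ?n = (i + ?d - ?n) mod ?n" by (simp add: le_mod_geq)
      also have "\<dots> = i + ?d - ?n" using assms by simp
      finally show ?thesis using False assms by auto
    qed (use assms in auto)
    moreover have "?d = ?n \<Longrightarrow> u = rotate i w" using eq_rotate_iff eqs letters by metis
    moreover have "\<not> closed_state ?W (seqw u) ?d i" using t assms(2) by (auto simp: closed_state_def)
    ultimately show ?thesis unfolding runo t using nb by auto
  qed
qed

lemma card_lower_closed:
  assumes "minimal (seqw w)" "1 \<le> length u" "length u \<le> length w"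
  shows "card {i. i < length w \<and> runo (lower_step True w) i u = Some i} =
    of_bool (good (seqw w) u) +
    of_bool (length u = length w) * card {i. i < length w \<and> u = rotate i w}"
proof -
  let ?C = "{i. i < length w \<and> closed_state (seqw w) (seqw u) (length u) i}"
  let ?R = "{i. i < length w \<and> length u = length w \<and> u = rotate i w}"
  have "?C \<inter> ?R = {}"
  proof (rule ccontr)
    assume "?C \<inter> ?R \<noteq> {}"
    then obtain i where i: "closed_state (seqw w) (seqw u) (length u) i" "length u = length w"
        "u = rotate i w" by blast
    then have "\<forall>s<length u. seqw u s = seqw w (i + s)"
      using eq_rotate_iff by (metis mod_less seqw_def)
    then have "traj (seqw w) (seqw u) i (length u) = i + length u" by (intro traj_no_reset) auto
    then show False using i(1) assms(2) by (simp add: closed_state_def)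
  qed
  moreover have "{i. i < length w \<and> runo (lower_step True w) i u = Some i} = ?C \<union> ?R"
    using runo_lower_closed[OF _ assms(2,3)] by blast
  moreover have "card ?C = of_bool (good (seqw w) u)"
    using card_closed[OF assms(1) seqw_periodic assms(2,3)] by (simp only: good_def)
  moreover have "card ?R = of_bool (length u = length w) * card {i. i < length w \<and> u = rotate i w}"
    by simp
  ultimately show ?thesis by (simp add: card_Un_disjoint)
qed

section \<open>Sums over all starting states\<close>

definition closed_walks :: "bool \<Rightarrow> word \<Rightarrow> nat \<Rightarrow> nat" where
  "closed_walks f w d = (\<Sum>i<length w. \<Sum>j<length w. walks f w i j d i j)"

text \<open>A closed walk of the product is a pair of closed walks with a common label, so for each
  word the numbers of closing states multiply.\<close>

lemma closed_walks_eq: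
  "closed_walks f w d = (\<Sum>u\<in>words d.
     card {i. i < length w \<and> runo (lower_step f w) i u = Some i} *
     card {j. j < length w \<and> runo (upper_step w) j (S u) = Some j})"
proof -
  let ?A = "\<lambda>i u. of_bool (runo (lower_step f w) i u = Some i) :: nat"
  let ?B = "\<lambda>j u. of_bool (runo (upper_step w) j (S u) = Some j) :: nat"
  have card: "card {x. x < length w \<and> P x} = (\<Sum>x<length w. of_bool (P x))" for P
  proof -
    have "{x. x < length w \<and> P x} = {..<length w} \<inter> {x. P x}" by auto
    then show ?thesis by (simp add: sum_of_bool_eq)
  qed
  have "walks f w i j d i j = (\<Sum>u\<in>words d. ?A i u * ?B j u)" if "i < length w" "j < length w" for i j
  proof -
    have "walk_words f w i j d (Some i) (Some j) = words d \<inter>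
        {u. runo (lower_step f w) i u = Some i \<and> runo (upper_step w) j (S u) = Some j}"
      by (auto simp: walk_words_def)
    then show ?thesis
      using that walks_eq_card[of i w j j f i d] finite_words[of d]
      by (simp add: of_bool_conj[symmetric] sum_of_bool_eq)
  qed
  then have "closed_walks f w d = (\<Sum>i<length w. \<Sum>j<length w. \<Sum>u\<in>words d. ?A i u * ?B j u)"
    unfolding closed_walks_def by (intro sum.cong refl) auto
  also have "\<dots> = (\<Sum>u\<in>words d. \<Sum>i<length w. \<Sum>j<length w. ?A i u * ?B j u)"
    by (rule trans[OF sum.cong[OF refl sum.swap] sum.swap])
  also have "\<dots> = (\<Sum>u\<in>words d. (\<Sum>i<length w. ?A i u) * (\<Sum>j<length w. ?B j u))"
    by (simp only: sum_product)
  finally show ?thesis by (simp only: card)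
qed

text \<open>The trivial first automaton closes at state 0 only and contributes the factor 1.\<close>

lemma closed_walks_upper:
  assumes "minimal (seqw w)" "1 \<le> d" "d \<le> length w"
  shows "closed_walks False w d = card {u \<in> words d. good (seqw w) (S u)}"
proof -
  have "closed_walks False w d = (\<Sum>u\<in>words d. of_bool (good (seqw w) (S u)))"
    unfolding closed_walks_eq
  proof (rule sum.cong[OF refl])
    fix u assume u: "u \<in> words d"
    then have len: "length u = d" "u \<noteq> []" using assms(2) by (auto simp: words_def)
    have "{i. i < length w \<and> runo (lower_step False w) i u = Some i} = {0}"
      using runo_lower_trivial[OF len(2), of w] assms by auto
    then show "card {i. i < length w \<and> runo (lower_step False w) i u = Some i} *
       card {j. j < length w \<and> runo (upper_step w) j (S u) = Some j} = of_bool (good (seqw w) (S u))"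
      using card_upper_closed[OF assms(1), of "S u"] len assms by simp
  qed
  also have "\<dots> = card {u \<in> words d. good (seqw w) (S u)}"
    using finite_words[of d] by (simp add: sum_of_bool_eq Int_def)
  finally show ?thesis .
qed

text \<open>The additional summand counts starting states, not words: each
  \<open>i < length w\<close> closes on \<open>rotate i w\<close>, also when some of these rotations
  coincide. So its value does not depend on the period of \<open>w\<close>.\<close>

lemma closed_walks_both:
  assumes W: "minimal (seqw w)" and d: "1 \<le> d" "d \<le> length w"
  shows "closed_walks True w d =
    card {u \<in> words d. good (seqw w) u \<and> good (seqw w) (S u)} +
    of_bool (d = length w) * (length w * of_bool (good (seqw w) (S w)))"
proof -
  let ?g = "good (seqw w)"
  have "closed_walks True w d = (\<Sum>u\<in>words d. of_bool (?g u \<and> ?g (S u)) +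
      of_bool (d = length w) * (\<Sum>i<length w. of_bool (u = rotate i w \<and> ?g (S u))))"
    unfolding closed_walks_eq
  proof (rule sum.cong[OF refl])
    fix u assume u: "u \<in> words d"
    then have len: "length u = d" using d by (auto simp: words_def)
    have R: "card {i. i < length w \<and> u = rotate i w} * of_bool (?g (S u)) =
        (\<Sum>i<length w. of_bool (u = rotate i w \<and> ?g (S u)))"
    proof -
      have "{i. i < length w \<and> u = rotate i w} = {..<length w} \<inter> {i. u = rotate i w}" by auto
      then show ?thesis by (auto simp: sum_of_bool_eq)
    qed
    have L: "card {i. i < length w \<and> runo (lower_step True w) i u = Some i} =
        of_bool (?g u) + of_bool (d = length w) * card {i. i < length w \<and> u = rotate i w}"
      using card_lower_closed[OF W, of u] len d by simp
    have U: "card {j. j < length w \<and> runo (upper_step w) j (S u) = Some j} = of_bool (?g (S u))"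
      using card_upper_closed[OF W, of "S u"] len d by simp
    show "card {i. i < length w \<and> runo (lower_step True w) i u = Some i} *
       card {j. j < length w \<and> runo (upper_step w) j (S u) = Some j} =
       of_bool (?g u \<and> ?g (S u)) +
       of_bool (d = length w) * (\<Sum>i<length w. of_bool (u = rotate i w \<and> ?g (S u)))"
      unfolding L U add_mult_distrib R[symmetric] by (simp only: of_bool_conj mult.assoc)
  qed
  also have "\<dots> = (\<Sum>u\<in>words d. of_bool (?g u \<and> ?g (S u))) +
      of_bool (d = length w) * (\<Sum>u\<in>words d. \<Sum>i<length w. of_bool (u = rotate i w \<and> ?g (S u)))"
    by (simp only: sum.distrib sum_distrib_left)
  also have "(\<Sum>u\<in>words d. \<Sum>i<length w. of_bool (u = rotate i w \<and> ?g (S u)) :: nat) =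
      (\<Sum>i<length w. \<Sum>u\<in>words d. of_bool (u = rotate i w \<and> ?g (S u)))"
    by (rule sum.swap)
  also have "(\<Sum>u\<in>words d. of_bool (?g u \<and> ?g (S u))) = card {u \<in> words d. ?g u \<and> ?g (S u)}"
    using finite_words[of d] by (simp only: sum_of_bool_eq) (simp add: Int_def)
  also have "of_bool (d = length w) * (\<Sum>i<length w. \<Sum>u\<in>words d. of_bool (u = rotate i w \<and> ?g (S u))) =
      of_bool (d = length w) * (length w * of_bool (?g (S w)) :: nat)"
  proof (cases "d = length w")
    case True
    have "(\<Sum>u\<in>words d. of_bool (u = rotate i w \<and> ?g (S u))) = (of_bool (?g (S w)) :: nat)" for i
    proof -
      have "rotate i w \<in> words d" "w \<noteq> []" using True d by (auto simp: words_def)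
      then have "words d \<inter> {u. u = rotate i w \<and> ?g (S u)} = (if ?g (S w) then {rotate i w} else {})"
        by (auto simp: S_rotate)
      then show ?thesis using finite_words[of d] by (simp add: sum_of_bool_eq)
    qed
    then show ?thesis by simp
  qed simp
  finally show ?thesis .
qed

section \<open>Orbit counting\<close>

lemma rotate_eq_iff_period:
  assumes "u \<noteq> []"
  shows "rotate k u = u \<longleftrightarrow> (\<forall>t. seqw u (t + k) = seqw u t)"
proof -
  have "rotate k u = u \<longleftrightarrow> seqw (rotate k u) = seqw u" using seqw_inj[of "rotate k u" u] by auto
  then show ?thesis using seqw_rotate[OF assms] by (auto simp: shift_def fun_eq_iff)
qed

text \<open>Euclid's algorithm performed on the periods.\<close>

lemma periods_gcd:
  assumes "\<forall>t. T (t + a) = T t" "\<forall>t. T (t + b) = T (t :: nat)"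
  shows "\<forall>t. T (t + gcd a b) = T t"
  using assms
proof (induction a b rule: gcd_nat_induct)
  case (step m k)
  have "T (t + m mod k) = T t" for t
  proof -
    have "T (t + m mod k) = T (t + m mod k + (m div k) * k)"
      using periodic_mult[OF step.prems(2)] by metis
    also have "\<dots> = T (t + m)" by (simp add: add.assoc)
    finally show ?thesis using step.prems(1) by simp
  qed
  then show ?case using step by (simp add: gcd_non_0_nat)
qed simp

text \<open>A fixed word has the periods \<open>k\<close> and \<open>m\<close>, hence their gcd, and
  its prefix of that length generates the same sequence. This is why \<open>Q\<close> is a predicate
  of sequences.\<close>

lemma card_fixed_words:
  assumes "1 \<le> m"
  shows "card {u \<in> words m. rotate k u = u \<and> Q (seqw u)} = card {v \<in> words (gcd k m). Q (seqw v)}"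
proof -
  define g where "g = gcd k m"
  have g: "1 \<le> g" "g dvd m" "g dvd k" "g \<le> m"
    using assms by (auto simp: g_def Suc_le_eq intro: dvd_imp_le)
  have per: "\<forall>t. seqw u (t + g) = seqw u t" if "u \<in> words m" "rotate k u = u" for u
  proof -
    have "length u = m" "u \<noteq> []" using that assms by (auto simp: words_def)
    then show ?thesis
      using periods_gcd[of "seqw u" k m] seqw_periodic[of u] rotate_eq_iff_period[of u k] that
      unfolding g_def by simp
  qed
  have take: "seqw (take g u) = seqw u" if "u \<in> words m" "rotate k u = u" for u
  proof
    fix t
    have len: "length u = m" using that by (simp add: words_def)
    have "t = t mod g + (t div g) * g" by simp
    then have "seqw u t = seqw u (t mod g)" using periodic_mult[OF per[OF that]] by metis
    moreover have "t mod g < g" using g by simp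
    ultimately show "seqw (take g u) t = seqw u t" using len g by (simp add: seqw_def min_absorb2)
  qed
  have "bij_betw (take g) {u \<in> words m. rotate k u = u \<and> Q (seqw u)} {v \<in> words g. Q (seqw v)}"
  proof (rule bij_betw_imageI)
    show "inj_on (take g) {u \<in> words m. rotate k u = u \<and> Q (seqw u)}"
    proof (rule inj_onI)
      fix u v
      assume u: "u \<in> {u \<in> words m. rotate k u = u \<and> Q (seqw u)}"
        and v: "v \<in> {u \<in> words m. rotate k u = u \<and> Q (seqw u)}" and "take g u = take g v"
      then have "seqw u = seqw v" using take by (metis (mono_tags, lifting) mem_Collect_eq)
      then show "u = v" using u v by (intro seqw_inj) (auto simp: words_def)
    qed
    show "take g ` {u \<in> words m. rotate k u = u \<and> Q (seqw u)} = {v \<in> words g. Q (seqw v)}"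
    proof (intro subset_antisym subsetI)
      fix v assume "v \<in> take g ` {u \<in> words m. rotate k u = u \<and> Q (seqw u)}"
      then obtain u where u: "u \<in> words m" "rotate k u = u" "Q (seqw u)" "v = take g u" by blast
      then show "v \<in> {v \<in> words g. Q (seqw v)}"
        using take[OF u(1,2)] g by (simp add: words_def min_absorb2)
    next
      fix v assume "v \<in> {v \<in> words g. Q (seqw v)}"
      then have v: "length v = g" "Q (seqw v)" by (auto simp: words_def)
      define u where "u = map (seqw v) [0..<m]"
      have len: "length u = m" "u \<noteq> []" using assms by (auto simp: u_def)
      have sv: "seqw u = seqw v"
      proof
        fix t
        have "t mod m < m" using assms by simp
        then have "seqw u t = v ! (t mod m mod g)" using len v by (simp add: seqw_def u_def)
        then show "seqw u t = seqw v t" using g v by (simp add: seqw_def mod_mod_cancel)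
      qed
      have "seqw v (t + k) = seqw v t" for t
        using periodic_mult[OF seqw_periodic[of v], of t "k div g"] v g by simp
      then have "rotate k u = u" using rotate_eq_iff_period[OF len(2)] sv by simp
      moreover have "take g u = v"
        using len g v by (intro nth_equalityI) (auto simp: u_def seqw_def)
      ultimately show "v \<in> take g ` {u \<in> words m. rotate k u = u \<and> Q (seqw u)}"
        using len sv v by (intro image_eqI[of _ _ u]) (auto simp: words_def)
    qed
  qed
  then show ?thesis unfolding g_def by (rule bij_betw_same_card)
qed

lemma rotate_minus:
  assumes "u \<noteq> []"
  shows "rotate (length u - k mod length u) (rotate k u) = u"
proof -
  have "k mod length u < length u" using assms by simp
  then have "length u - k mod length u + k = (k div length u + 1) * length u"
    using div_mult_mod_eq[of k "length u"] unfolding add_mult_distrib by linarith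
  then show ?thesis by (simp add: rotate_rotate rotate_id)
qed

text \<open>Orbit and stabiliser for a single orbit. Rotations commute, so \<open>rotate k\<close>
  fixes all of \<open>N\<close> or nothing, and every word of \<open>N\<close> is reached from
  \<open>x\<close> by equally many \<open>k\<close>.\<close>

lemma orbit_sum:
  assumes N: "N \<in> necklaces m" and m: "1 \<le> m"
  shows "(\<Sum>k=1..m. card {u \<in> N. rotate k u = u}) = m"
proof -
  obtain x where x: "length x = m" "N = rot_rel `` {x}"
    using N by (auto simp: necklaces_def quotient_def words_def)
  have ne: "x \<noteq> []" using x m by auto
  have NN: "N = (\<lambda>k. rotate k x) ` {1..m}"
  proof (intro subset_antisym subsetI)
    fix u assume "u \<in> N"
    then obtain k where k: "u = rotate k x" using x by (auto simp: rot_rel_def)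
    show "u \<in> (\<lambda>k. rotate k x) ` {1..m}"
    proof (cases "k mod m = 0")
      case True
      then have "u = rotate m x" using k x rotate_conv_mod[of k x] by (simp add: rotate_id)
      then show ?thesis using m by auto
    next
      case False
      then have "u = rotate (k mod m) x" "k mod m \<in> {1..m}"
        using k x m rotate_conv_mod[of k x] by (auto simp: Suc_le_eq less_imp_le)
      then show ?thesis by blast
    qed
  qed (auto simp: x rot_rel_def)
  have fixed: "rotate k (rotate i x) = rotate i x \<longleftrightarrow> rotate k x = x" for k i
  proof
    assume "rotate k (rotate i x) = rotate i x"
    then have "rotate i (rotate k x) = rotate i x" by (simp only: rotate_rotate add.commute)
    then show "rotate k x = x"
      using rotate_minus[of x i] rotate_minus[of "rotate k x" i] ne by simp
  qed (metis rotate_rotate add.commute)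
  define Z where "Z = {k \<in> {1..m}. rotate k x = x}"
  have fin: "finite N" unfolding NN by simp
  have "(\<Sum>k=1..m. card {u \<in> N. rotate k u = u}) = (\<Sum>k=1..m. if rotate k x = x then card N else 0)"
  proof (rule sum.cong[OF refl])
    fix k
    have "{u \<in> N. rotate k u = u} = (if rotate k x = x then N else {})" unfolding NN using fixed by auto
    then show "card {u \<in> N. rotate k u = u} = (if rotate k x = x then card N else 0)" by simp
  qed
  also have "\<dots> = card N * card Z" unfolding Z_def by (simp add: sum.If_cases Int_def)
  also have "\<dots> = (\<Sum>u\<in>N. card {k \<in> {1..m}. rotate k x = u})"
  proof -
    have "card {k \<in> {1..m}. rotate k x = u} = card Z" if "u \<in> N" for u
    proof -
      obtain i where i: "i \<in> {1..m}" "u = rotate i x" using \<open>u \<in> N\<close> NN by blast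
      \<comment> \<open>Addition of \<open>i\<close> modulo \<open>m\<close> with representatives
        \<open>1, ..., m\<close>; it carries the rotations fixing \<open>x\<close> to those taking
        \<open>x\<close> to \<open>u\<close>.\<close>
      define r where "r k = (if k + i \<le> m then k + i else k + i - m)" for k
      have rot: "rotate (r k) x = rotate i (rotate k x)" for k
      proof (cases "k + i \<le> m")
        case False
        then have "rotate i (rotate k x) = rotate (r k + length x) x"
          by (simp add: r_def rotate_rotate x add.commute)
        also have "\<dots> = rotate (r k) (rotate (length x) x)" by (simp only: rotate_rotate)
        finally show ?thesis by simp
      qed (simp add: r_def rotate_rotate add.commute)
      have inv: "rotate i (rotate k x) = rotate i x \<longleftrightarrow> rotate k x = x" for k
        using fixed[of k i] by (simp only: rotate_rotate add.commute)
      have "bij_betw r Z {k \<in> {1..m}. rotate k x = u}"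
      proof (rule bij_betw_imageI)
        show "inj_on r Z" using i by (auto simp: inj_on_def r_def Z_def split: if_splits)
        show "r ` Z = {k \<in> {1..m}. rotate k x = u}"
        proof (intro subset_antisym subsetI)
          fix k assume "k \<in> r ` Z"
          then obtain l where l: "l \<in> {1..m}" "rotate l x = x" "k = r l" by (auto simp: Z_def)
          then have "rotate k x = u" using rot[of l] i by simp
          moreover have "k \<in> {1..m}" using l i by (auto simp: r_def)
          ultimately show "k \<in> {k \<in> {1..m}. rotate k x = u}" by simp
        next
          fix k assume k: "k \<in> {k \<in> {1..m}. rotate k x = u}"
          define k' where "k' = (if i < k then k - i else k + m - i)"
          have "r k' = k" "k' \<in> {1..m}" using k i by (auto simp: r_def k'_def)
          moreover have "rotate k' x = x" using rot[of k'] inv[of k'] k i \<open>r k' = k\<close> by simp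
          ultimately show "k \<in> r ` Z" by (auto simp: Z_def intro!: image_eqI[of k r k'])
        qed
      qed
      then show ?thesis by (metis bij_betw_same_card)
    qed
    then show ?thesis by simp
  qed
  also have "\<dots> = card (\<Union>u\<in>N. {k \<in> {1..m}. rotate k x = u})"
    by (rule card_UN_disjoint[symmetric]) (use fin in auto)
  also have "(\<Union>u\<in>N. {k \<in> {1..m}. rotate k x = u}) = {1..m}" using NN by auto
  finally show ?thesis by simp
qed

section \<open>The rank as a difference of counts\<close>

text \<open>The condition of \<open>good\<close> as a predicate of sequences, the form in which
  \<open>card_fixed_words\<close> can transport it between lengths.\<close>

definition seq_good :: "(nat \<Rightarrow> bool) \<Rightarrow> (nat \<Rightarrow> bool) \<Rightarrow> bool" where
  "seq_good W T \<longleftrightarrow> (\<forall>p. seq_less W (shift p T))"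

lemma good_seq: "good W u = seq_good W (seqw u)"
  by (simp add: good_def seq_good_def)

lemma good_S_seq: "u \<noteq> [] \<Longrightarrow> good W (S u) = seq_good W (\<lambda>t. \<not> seqw u t)"
proof -
  assume "u \<noteq> []"
  then have "seqw (S u) = (\<lambda>t. \<not> seqw u t)" using seqw_S by auto
  then show ?thesis by (simp add: good_seq)
qed

lemma necklace_words:
  assumes "N \<in> necklaces m" "1 \<le> m" "u \<in> N"
  shows "length u = m" "u \<noteq> []" "N = rot_rel `` {u}" "rotate k u \<in> N"
proof -
  obtain x where x: "length x = m" "N = rot_rel `` {x}"
    using assms(1) by (auto simp: necklaces_def quotient_def words_def)
  then show "length u = m" using assms(3) by (auto simp: rot_rel_def)
  then show "u \<noteq> []" using assms(2) by auto
  have "(x, u) \<in> rot_rel" using x assms(3) by simp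
  then show N: "N = rot_rel `` {u}" unfolding x(2) by (rule equiv_class_eq[OF equiv_rot_rel])
  show "rotate k u \<in> N" unfolding N by (auto simp: rot_rel_def)
qed

lemma necklace_of_word: "u \<in> words m \<Longrightarrow> rot_rel `` {u} \<in> necklaces m" "u \<in> rot_rel `` {u}"
  using rot_rel_refl by (auto simp: necklaces_def quotient_def)

lemma necklaces_facts:
  shows "finite (necklaces m)" "N \<in> necklaces m \<Longrightarrow> N \<noteq> {}" "N \<in> necklaces m \<Longrightarrow> N \<subseteq> words m"
proof -
  have "necklaces m = (\<lambda>x. rot_rel `` {x}) ` words m" by (auto simp: necklaces_def quotient_def)
  then show "finite (necklaces m)" using finite_words by simp
qed (auto simp: necklaces_def quotient_def words_def rot_rel_def)

text \<open>Pairs of a \<open>k\<close> and a word fixed by \<open>rotate k\<close> are counted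
  twice: by necklaces, each contributing \<open>m\<close>, and by \<open>k\<close>.\<close>

theorem necklace_count:
  assumes m: "1 \<le> m" and Q: "\<And>u k. u \<in> words m \<Longrightarrow> Q (seqw (rotate k u)) = Q (seqw u)"
  shows "card {N \<in> necklaces m. \<forall>u\<in>N. Q (seqw u)} * m =
    (\<Sum>k=1..m. card {v \<in> words (gcd k m). Q (seqw v)})"
proof -
  let ?\<N> = "{N \<in> necklaces m. \<forall>u\<in>N. Q (seqw u)}"
  have fin: "finite ?\<N>" using necklaces_facts(1) by simp
  have finN: "finite N" if "N \<in> ?\<N>" for N
    using that finite_subset[OF necklaces_facts(3) finite_words] by blast
  have cover: "{u \<in> words m. rotate k u = u \<and> Q (seqw u)} = (\<Union>N\<in>?\<N>. {u \<in> N. rotate k u = u})" for k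
  proof (intro subset_antisym subsetI)
    fix u assume u: "u \<in> {u \<in> words m. rotate k u = u \<and> Q (seqw u)}"
    then have "\<forall>v\<in>rot_rel `` {u}. Q (seqw v)" using Q by (auto simp: rot_rel_def)
    then have "rot_rel `` {u} \<in> ?\<N>" using necklace_of_word(1) u by blast
    then show "u \<in> (\<Union>N\<in>?\<N>. {u \<in> N. rotate k u = u})" using necklace_of_word(2) u by blast
  qed (use necklaces_facts(3) in blast)
  have disj: "{u \<in> N. rotate k u = u} \<inter> {u \<in> N'. rotate k u = u} = {}"
    if "N \<in> ?\<N>" "N' \<in> ?\<N>" "N \<noteq> N'" for N N' k
  proof (rule ccontr)
    assume "{u \<in> N. rotate k u = u} \<inter> {u \<in> N'. rotate k u = u} \<noteq> {}"
    then obtain u where "u \<in> N" "u \<in> N'" by blast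
    then show False using necklace_words(3)[OF _ m] that by blast
  qed
  have "(\<Sum>k=1..m. card {v \<in> words (gcd k m). Q (seqw v)}) =
      (\<Sum>k=1..m. card {u \<in> words m. rotate k u = u \<and> Q (seqw u)})"
    using card_fixed_words[OF m] by simp
  also have "\<dots> = (\<Sum>k=1..m. \<Sum>N\<in>?\<N>. card {u \<in> N. rotate k u = u})"
    unfolding cover using fin finN disj by (intro sum.cong refl card_UN_disjoint) auto
  also have "\<dots> = (\<Sum>N\<in>?\<N>. \<Sum>k=1..m. card {u \<in> N. rotate k u = u})" by (rule sum.swap)
  also have "\<dots> = (\<Sum>N\<in>?\<N>. m)" using orbit_sum m by (intro sum.cong refl) blast
  finally show ?thesis by simp
qed

section \<open>Enclosing classes in terms of rotations\<close>

lemma word_less_trans: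
  assumes "word_less a b" "word_less b c" "a \<noteq> []" "b \<noteq> []" "c \<noteq> []"
  shows "word_less a c"
  using assms(1,2)
  unfolding word_less_iff[OF assms(4,3)] word_less_iff[OF assms(5,4)] word_less_iff[OF assms(5,3)]
  by (auto intro: seq_less_trans)

lemma word_less_asym:
  assumes "word_less a b" "word_less b a" "a \<noteq> []" "b \<noteq> []"
  shows False
  using assms(1,2) unfolding word_less_iff[OF assms(4,3)] word_less_iff[OF assms(3,4)]
  by (auto dest: seq_less_asym simp: seq_less_irrefl)

lemma canon_less_iff:
  assumes X: "X \<subseteq> words m" "X \<noteq> {}" and m: "1 \<le> m" and w: "w \<noteq> []"
  shows "word_less (canon X) w \<longleftrightarrow> (\<exists>r\<in>X. word_less r w)"
    "word_less w (canon X) \<longleftrightarrow> (\<forall>r\<in>X. word_less w r)"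
proof -
  have ne: "r \<noteq> []" if "r \<in> X" for r using that X(1) m by (auto simp: words_def)
  note c = canon_least[OF X m]
  show "word_less (canon X) w \<longleftrightarrow> (\<exists>r\<in>X. word_less r w)"
    using c ne word_less_trans[OF _ _ _ _ w] by metis
  show "word_less w (canon X) \<longleftrightarrow> (\<forall>r\<in>X. word_less w r)"
    using c ne word_less_trans[OF _ _ w] by metis
qed

lemma S_image_class: "S ` (rot_rel `` {x}) = rot_rel `` {S x}"
proof (intro subset_antisym subsetI)
  fix y assume "y \<in> rot_rel `` {S x}"
  then have "(S (S x), S y) \<in> rot_rel" using rot_rel_S by blast
  then show "y \<in> S ` (rot_rel `` {x})" by (auto intro!: image_eqI[of y S "S y"])
qed (use rot_rel_S in auto)

lemma unlabelled_class: "unl_rel `` {x} = rot_rel `` {x} \<union> S ` (rot_rel `` {x})"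
  unfolding S_image_class by (auto simp: unl_rel_iff)

lemma S_necklace: "N \<in> necklaces m \<Longrightarrow> S ` N \<in> necklaces m"
  using necklace_of_word(1)[of "S _" m]
  by (auto simp: necklaces_def quotient_def S_image_class words_def)

text \<open>An enclosing class is represented by that one of its two necklaces whose canonical
  representation is below \<open>w\<close>. The other lies above \<open>w\<close>, so the choice is
  unique and the two are distinct.\<close>

lemma RankEN_eq_card_necklaces:
  assumes m: "1 \<le> m" and w: "w \<noteq> []"
  shows "RankEN w m = card {N \<in> necklaces m. (\<exists>r\<in>N. word_less r w) \<and> (\<forall>r\<in>N. word_less w (S r))}"
proof -
  let ?R = "{N \<in> necklaces m. word_less (canon N) w \<and> word_less w (canon (S ` N))}"
  let ?f = "\<lambda>N. N \<union> S ` N"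
  have canon_ne: "canon N \<noteq> []" if "N \<in> necklaces m" for N
    using canon_least(1)[of N m] necklaces_facts that m necklace_words(2) by blast
  have "bij_betw ?f ?R {A \<in> unlabelled_necklaces m. encloses A w \<and> word_less (canon A) w}"
  proof (rule bij_betw_imageI)
    show "inj_on ?f ?R"
    proof (rule inj_onI)
      fix N N' assume N: "N \<in> ?R" and N': "N' \<in> ?R" and eq: "?f N = ?f N'"
      obtain x where x: "x \<in> N'" using N' necklaces_facts(2) by blast
      then have "x \<in> N \<or> x \<in> S ` N" using eq by blast
      then show "N = N'"
      proof
        assume "x \<in> N"
        then show ?thesis using x N N' necklace_words(3)[OF _ m] by blast
      next
        assume "x \<in> S ` N"
        then have "N' = S ` N" using x N N' necklace_words(3)[OF _ m] S_necklace by blast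
        then have "word_less (canon N') w" "word_less w (canon N')" using N N' by auto
        then show ?thesis using word_less_asym canon_ne N' w by blast
      qed
    qed
    show "?f ` ?R = {A \<in> unlabelled_necklaces m. encloses A w \<and> word_less (canon A) w}"
    proof (intro subset_antisym subsetI)
      fix A assume "A \<in> ?f ` ?R"
      then obtain N where N: "N \<in> necklaces m" "word_less (canon N) w" "word_less w (canon (S ` N))"
          "A = N \<union> S ` N" by blast
      obtain x where x: "x \<in> words m" "N = rot_rel `` {x}"
        using N(1) by (auto simp: necklaces_def quotient_def)
      have A: "A = unl_rel `` {x}" using N(4) x(2) unlabelled_class by simp
      have "N \<noteq> S ` N" using N word_less_asym canon_ne w by metis
      then have "encloses A w" unfolding encloses_def using N by blast
      moreover have "A \<in> unlabelled_necklaces m" using A x by (auto simp: unlabelled_necklaces_def quotient_def)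
      moreover have "word_less (canon A) w"
      proof -
        have sub: "A \<subseteq> words m" "A \<noteq> {}"
          using N necklaces_facts(2)[of N m] necklaces_facts(3)[of N m] necklaces_facts(3)[OF S_necklace[OF N(1)]] by auto
        have "canon N \<in> A" using canon_least(1)[of N m] necklaces_facts N m by blast
        then show ?thesis unfolding canon_less_iff(1)[OF sub m w] using N(2) by blast
      qed
      ultimately show "A \<in> {A \<in> unlabelled_necklaces m. encloses A w \<and> word_less (canon A) w}" by simp
    next
      fix A assume "A \<in> {A \<in> unlabelled_necklaces m. encloses A w \<and> word_less (canon A) w}"
      then obtain m' N where N: "A \<in> unlabelled_necklaces m" "N \<in> necklaces m'" "A = N \<union> S ` N"
          "word_less (canon N) w" "word_less w (canon (S ` N))"
        unfolding encloses_def by blast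
      \<comment> \<open>\<open>encloses\<close> brings its own length \<open>m'\<close>; a common
        word identifies it with \<open>m\<close>.\<close>
      have "A \<subseteq> words m"
        using N(1) by (auto simp: unlabelled_necklaces_def quotient_def unl_rel_def words_def)
      moreover obtain x where "x \<in> N" using necklaces_facts(2)[OF N(2)] by blast
      ultimately have "m' = m" using N(2,3) necklaces_facts(3)[OF N(2)] by (auto simp: words_def)
      then show "A \<in> ?f ` ?R" using N by blast
    qed
  qed
  then have "RankEN w m = card ?R" unfolding RankEN_def by (simp add: bij_betw_same_card)
  also have "?R = {N \<in> necklaces m. (\<exists>r\<in>N. word_less r w) \<and> (\<forall>r\<in>N. word_less w (S r))}"
  proof -
    have "word_less (canon N) w \<longleftrightarrow> (\<exists>r\<in>N. word_less r w)"
        "word_less w (canon (S ` N)) \<longleftrightarrow> (\<forall>r\<in>N. word_less w (S r))" if "N \<in> necklaces m" for N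
      using canon_less_iff(1)[of N m w] canon_less_iff(2)[of "S ` N" m w] m w that
        necklaces_facts(2,3)[of N m] necklaces_facts(2,3)[OF S_necklace[OF that]] by auto
    then show ?thesis by blast
  qed
  finally show ?thesis .
qed

lemma seq_good_shift:
  assumes "u \<noteq> []"
  shows "seq_good W (seqw (rotate k u)) = seq_good W (seqw u)"
    "seq_good W (\<lambda>t. \<not> seqw (rotate k u) t) = seq_good W (\<lambda>t. \<not> seqw u t)"
proof -
  show "seq_good W (seqw (rotate k u)) = seq_good W (seqw u)"
    using good_rotate[OF assms, of W k] unfolding good_seq .
  show "seq_good W (\<lambda>t. \<not> seqw (rotate k u) t) = seq_good W (\<lambda>t. \<not> seqw u t)"
    using good_rotate[of "S u" W k] good_S_seq[of u W] good_S_seq[of "rotate k u" W] assms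
    by (simp add: S_rotate)
qed

lemma good_necklace:
  assumes "N \<in> necklaces m" "1 \<le> m" "\<forall>r\<in>N. seq_less W (seqw r)" "u \<in> N"
  shows "good W u"
  unfolding good_def
proof
  fix p
  have "u \<noteq> []" "rotate p u \<in> N" using necklace_words[OF assms(1,2,4)] by auto
  then show "seq_less W (shift p (seqw u))" using assms(3) seqw_rotate by metis
qed

lemma good_imp_less: "good W u \<Longrightarrow> seq_less W (seqw u)"
  unfolding good_def by (drule spec[of _ 0]) (simp add: shift_def)

text \<open>The last summand is the necklace of \<open>w\<close>: no rotation of \<open>w\<close> is
  below \<open>w\<close>, yet \<open>w\<close> is not good, goodness being strict. For
  \<open>m < length w\<close> a word generating the same sequence is smaller than \<open>w\<close>
  by its length, so no such exception arises.\<close>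

lemma enclosed_necklaces_split:
  assumes W: "minimal (seqw w)" and m: "1 \<le> m" "m \<le> length w"
  shows "card {N \<in> necklaces m. \<forall>u\<in>N. good (seqw w) (S u)} =
    RankEN w m + card {N \<in> necklaces m. \<forall>u\<in>N. good (seqw w) u \<and> good (seqw w) (S u)} +
    of_bool (m = length w \<and> good (seqw w) (S w))"
proof -
  let ?g = "good (seqw w)"
  let ?X = "{N \<in> necklaces m. \<forall>u\<in>N. ?g (S u)}"
  let ?Y = "{N \<in> necklaces m. \<forall>u\<in>N. ?g u \<and> ?g (S u)}"
  let ?R = "{N \<in> necklaces m. (\<exists>r\<in>N. word_less r w) \<and> (\<forall>r\<in>N. word_less w (S r))}"
  define E where "E = (if m = length w \<and> ?g (S w) then {rot_rel `` {w}} else {})"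
  have w: "w \<noteq> []" using m by auto
  have fin: "finite (necklaces m)" by (rule necklaces_facts)
  have upper: "(\<forall>r\<in>N. word_less w (S r)) \<longleftrightarrow> (\<forall>r\<in>N. ?g (S r))" if N: "N \<in> necklaces m" for N
  proof -
    have eq: "word_less w (S r) \<longleftrightarrow> seq_less (seqw w) (seqw (S r))" if "r \<in> N" for r
      using word_less_iff[of "S r" w] w necklace_words(1,2)[OF N m(1) that] m(2) by auto
    show ?thesis
    proof
      assume *: "\<forall>r\<in>N. word_less w (S r)"
      have "\<forall>r\<in>S ` N. seq_less (seqw w) (seqw r)" using * eq by auto
      then show "\<forall>r\<in>N. ?g (S r)" using good_necklace[OF S_necklace[OF N] m(1)] by blast
    qed (use eq good_imp_less in blast)
  qed
  have lower: "(\<exists>r\<in>N. word_less r w) \<longleftrightarrow> \<not> (\<forall>r\<in>N. ?g r) \<and> N \<notin> {N. m = length w \<and> N = rot_rel `` {w}}"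
    if N: "N \<in> necklaces m" for N
  proof -
    have less: "word_less r w \<longleftrightarrow> seq_less (seqw r) (seqw w) \<or> (seqw r = seqw w \<and> m < length w)"
      if "r \<in> N" for r
      using word_less_iff[of w r] w necklace_words(1,2)[OF N m(1) that] by auto
    show ?thesis
    proof
      assume "\<exists>r\<in>N. word_less r w"
      then obtain r where r: "r \<in> N" "word_less r w" by blast
      then have "\<not> seq_less (seqw w) (seqw r)" using less seq_less_asym seq_less_irrefl by metis
      then have "\<not> ?g r" using good_imp_less by blast
      moreover have "\<not> (m = length w \<and> N = rot_rel `` {w})"
      proof
        assume *: "m = length w \<and> N = rot_rel `` {w}"
        then obtain k where k: "r = rotate k w" using r(1) by (auto simp: rot_rel_def)
        have "seq_less (seqw r) (seqw w)" using less[OF r(1)] r(2) * by simp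
        then show False using W seqw_rotate[OF w] k by (simp add: minimal_def)
      qed
      ultimately show "\<not> (\<forall>r\<in>N. ?g r) \<and> N \<notin> {N. m = length w \<and> N = rot_rel `` {w}}"
        using r(1) by blast
    next
      assume *: "\<not> (\<forall>r\<in>N. ?g r) \<and> N \<notin> {N. m = length w \<and> N = rot_rel `` {w}}"
      then obtain r where r: "r \<in> N" "\<not> seq_less (seqw w) (seqw r)"
        using good_necklace[OF N m(1)] by blast
      then have c: "seqw r = seqw w \<or> seq_less (seqw r) (seqw w)" using seq_less_linear by blast
      have "word_less r w"
      proof (cases "m = length w")
        case True
        have "seqw r \<noteq> seqw w"
        proof
          assume "seqw r = seqw w"
          then have "r = w" using necklace_words(1)[OF N m(1) r(1)] True seqw_inj by blast
          then show False using * True necklace_words(3)[OF N m(1) r(1)] by blast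
        qed
        then show ?thesis using c less[OF r(1)] by blast
      next
        case False
        then show ?thesis using c less[OF r(1)] m(2) by auto
      qed
      then show "\<exists>r\<in>N. word_less r w" using r(1) by blast
    qed
  qed
  have E: "E \<subseteq> ?X" "E \<inter> ?Y = {}" "E \<inter> ?R = {}"
    "\<And>N. N \<in> ?X \<Longrightarrow> m = length w \<and> N = rot_rel `` {w} \<Longrightarrow> N \<in> E"
  proof -
    have *: "rot_rel `` {w} \<in> necklaces m" "w \<in> rot_rel `` {w}" if "m = length w"
      using necklace_of_word(1)[of w m] necklace_of_word(2)[of w] that by (auto simp: words_def)
    show "E \<subseteq> ?X"
    proof
      fix N assume "N \<in> E"
      then have N: "N = rot_rel `` {w}" "m = length w" "?g (S w)" by (auto simp: E_def split: if_splits)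
      then have "?g (S u)" if "u \<in> N" for u
        using that w good_rotate[of "S w" "seqw w"] by (auto simp: rot_rel_def S_rotate)
      then show "N \<in> ?X" using * N by blast
    qed
    have "\<not> ?g w" using good_imp_less seq_less_irrefl by blast
    then show "E \<inter> ?Y = {}" using *(2) by (auto simp: E_def split: if_splits)
    show "E \<inter> ?R = {}" using lower by (auto simp: E_def split: if_splits)
    show "\<And>N. N \<in> ?X \<Longrightarrow> m = length w \<and> N = rot_rel `` {w} \<Longrightarrow> N \<in> E"
      using *(2) by (auto simp: E_def)
  qed
  have YR: "?Y \<inter> ?R = {}" using lower by blast
  have X: "?X = ?R \<union> ?Y \<union> E"
  proof (intro subset_antisym subsetI)
    fix N assume N: "N \<in> ?X"
    then show "N \<in> ?R \<union> ?Y \<union> E" using upper[of N] lower[of N] E(4)[OF N] by blast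
  next
    fix N assume "N \<in> ?R \<union> ?Y \<union> E"
    then show "N \<in> ?X" using upper[of N] E(1) by blast
  qed
  have "card ?X = card ?R + card ?Y + card E"
    unfolding X using fin YR E(2,3) finite_subset[OF E(1)]
    by (subst card_Un_disjoint; (subst card_Un_disjoint)?) auto
  then show ?thesis using RankEN_eq_card_necklaces[OF m(1) w] by (simp add: E_def)
qed

text \<open>The difference of the sums is \<open>RankEN w m * m\<close>, so truncated subtraction
  and integer division are exact here.\<close>

theorem RankEN_formula:
  assumes W: "minimal (seqw w)" and m: "1 \<le> m" "m \<le> length w"
  shows "RankEN w m = ((\<Sum>k=1..m. closed_walks False w (gcd k m)) -
    (\<Sum>k=1..m. closed_walks True w (gcd k m))) div m"
proof -
  let ?g = "good (seqw w)" and ?n = "length w"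
  let ?X = "{N \<in> necklaces m. \<forall>u\<in>N. ?g (S u)}"
  let ?Y = "{N \<in> necklaces m. \<forall>u\<in>N. ?g u \<and> ?g (S u)}"
  let ?QX = "\<lambda>T. seq_good (seqw w) (\<lambda>t. \<not> T t)"
  let ?QY = "\<lambda>T. seq_good (seqw w) T \<and> seq_good (seqw w) (\<lambda>t. \<not> T t)"
  have gcd: "1 \<le> gcd k m" "gcd k m \<le> ?n" for k
  proof -
    have "gcd k m \<le> m" using m(1) by (intro dvd_imp_le) auto
    then show "gcd k m \<le> ?n" using m(2) by simp
    show "1 \<le> gcd k m" using m(1) by (simp add: Suc_le_eq)
  qed
  have ne: "u \<noteq> []" if "u \<in> words d" "1 \<le> d" for u d using that by (auto simp: words_def)
  have neN: "u \<noteq> []" if "N \<in> necklaces m" "u \<in> N" for u N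
    using necklace_words(2) that m(1) by blast
  have "(\<Sum>k=1..m. closed_walks False w (gcd k m)) =
      (\<Sum>k=1..m. card {v \<in> words (gcd k m). ?QX (seqw v)})"
  proof (rule sum.cong[OF refl])
    fix k
    show "closed_walks False w (gcd k m) = card {v \<in> words (gcd k m). ?QX (seqw v)}"
      unfolding closed_walks_upper[OF W gcd]
      by (rule arg_cong[of _ _ card]) (use good_S_seq ne[OF _ gcd(1)] in blast)
  qed
  also have "\<dots> = card {N \<in> necklaces m. \<forall>u\<in>N. ?QX (seqw u)} * m"
    by (rule necklace_count[symmetric, OF m(1)]) (use seq_good_shift(2) ne m(1) in blast)
  also have "{N \<in> necklaces m. \<forall>u\<in>N. ?QX (seqw u)} = ?X"
    using good_S_seq neN by blast
  finally have X: "(\<Sum>k=1..m. closed_walks False w (gcd k m)) = card ?X * m" .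
  have "(\<Sum>k=1..m. closed_walks True w (gcd k m)) =
      (\<Sum>k=1..m. card {v \<in> words (gcd k m). ?QY (seqw v)} +
        of_bool (k = m) * (of_bool (m = ?n) * (?n * of_bool (?g (S w)))))"
  proof (rule sum.cong[OF refl])
    fix k assume k: "k \<in> {1..m}"
    have 1: "{u \<in> words (gcd k m). ?g u \<and> ?g (S u)} = {v \<in> words (gcd k m). ?QY (seqw v)}"
      using good_S_seq good_seq ne[OF _ gcd(1)] by blast
    have "gcd k m \<le> k" "gcd k m \<le> m" using k m by (auto intro!: dvd_imp_le)
    \<comment> \<open>Since \<open>gcd k m \<le> k \<le> m \<le> n\<close>, the additional closed
      walks enter the sum once, for \<open>k = m\<close>. Their number \<open>n = m\<close> is
      \<open>m\<close> times one necklace.\<close>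
    have 2: "gcd k m = ?n \<longleftrightarrow> k = m \<and> m = ?n"
    proof
      assume "gcd k m = ?n"
      then have "?n \<le> k" "?n \<le> m"
        using \<open>gcd k m \<le> k\<close> \<open>gcd k m \<le> m\<close> by linarith+
      then show "k = m \<and> m = ?n" using k m by auto
    qed auto
    show "closed_walks True w (gcd k m) = card {v \<in> words (gcd k m). ?QY (seqw v)} +
        of_bool (k = m) * (of_bool (m = ?n) * (?n * of_bool (?g (S w))))"
      unfolding closed_walks_both[OF W gcd] 1 2 by (simp only: of_bool_conj mult.assoc)
  qed
  also have "\<dots> = (\<Sum>k=1..m. card {v \<in> words (gcd k m). ?QY (seqw v)}) +
      of_bool (m = ?n) * (?n * of_bool (?g (S w)))"
    using m(1) by (simp add: sum.distrib sum_distrib_right[symmetric] of_bool_def sum.delta)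
  also have "(\<Sum>k=1..m. card {v \<in> words (gcd k m). ?QY (seqw v)}) =
      card {N \<in> necklaces m. \<forall>u\<in>N. ?QY (seqw u)} * m"
    by (rule necklace_count[symmetric, OF m(1)]) (use seq_good_shift ne m(1) in blast)
  also have "{N \<in> necklaces m. \<forall>u\<in>N. ?QY (seqw u)} = ?Y"
    using good_S_seq good_seq neN by blast
  finally have Y: "(\<Sum>k=1..m. closed_walks True w (gcd k m)) =
      card ?Y * m + of_bool (m = ?n) * (?n * of_bool (?g (S w)))" .
  have "card ?X * m = (RankEN w m + card ?Y + of_bool (m = ?n \<and> ?g (S w))) * m"
    using enclosed_necklaces_split[OF W m] by simp
  then have "card ?X * m = RankEN w m * m + (\<Sum>k=1..m. closed_walks True w (gcd k m))"
    unfolding Y by (auto simp: add_mult_distrib)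
  then show ?thesis unfolding X using m(1) by simp
qed

section \<open>A cost-aware program logic\<close>

text \<open>Total correctness with a cost bound, existential in the run as in
  \<open>computes_within\<close>.\<close>

definition hoare :: "(memory \<Rightarrow> bool) \<Rightarrow> com \<Rightarrow> nat \<Rightarrow> (memory \<Rightarrow> bool) \<Rightarrow> bool" where
  "hoare P c K Q \<longleftrightarrow> (\<forall>s. P s \<longrightarrow> (\<exists>k t. exec c s k t \<and> k \<le> K \<and> Q t))"

lemma hoare_Seq:
  assumes "hoare P c K Q" "hoare Q d L R"
  shows "hoare P (Seq c d) (K + L) R"
  unfolding hoare_def
proof (intro allI impI)
  fix s assume "P s"
  then obtain k t where t: "exec c s k t" "k \<le> K" "Q t" using assms(1) by (auto simp: hoare_def)
  then obtain l u where "exec d t l u" "l \<le> L" "R u" using assms(2) by (auto simp: hoare_def)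
  then show "\<exists>k t. exec (Seq c d) s k t \<and> k \<le> K + L \<and> R t"
    using t exec.Seq add_mono by meson
qed

lemma hoare_conseq:
  assumes "hoare P c K Q" "\<And>s. P' s \<Longrightarrow> P s" "\<And>s. Q s \<Longrightarrow> Q' s" "K \<le> K'"
  shows "hoare P' c K' Q'"
  using assms unfolding hoare_def by (meson order_trans)

text \<open>The number of \<open>bits\<close> summands in \<open>acost\<close>.\<close>

fun nodes :: "aexp \<Rightarrow> nat" where
  "nodes (Const c) = 1"
| "nodes (Contents e) = nodes e + 2"
| "nodes (Op f a b) = nodes a + nodes b + 2"

text \<open>Every number handled in the evaluation of the expression has at most \<open>B\<close> bits.\<close>

fun ok :: "nat \<Rightarrow> aexp \<Rightarrow> memory \<Rightarrow> bool" where
  "ok B (Const c) s \<longleftrightarrow> c < 2 ^ B"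
| "ok B (Contents e) s \<longleftrightarrow> ok B e s \<and> s (aval e s) < 2 ^ B"
| "ok B (Op f a b) s \<longleftrightarrow> ok B a s \<and> ok B b s \<and> apply_op f (aval a s) (aval b s) < 2 ^ B"

lemma ok_aval: "ok B e s \<Longrightarrow> aval e s < 2 ^ B"
  by (cases e) auto

lemma bits_le: "x < 2 ^ B \<Longrightarrow> 1 \<le> B \<Longrightarrow> bits x \<le> B"
  unfolding bits_def using floorlog_leI[of x 2 B] by simp

lemma acost_le: "ok B e s \<Longrightarrow> 1 \<le> B \<Longrightarrow> acost e s \<le> nodes e * B"
proof (induction e)
  case (Contents e)
  then have "bits (aval e s) \<le> B" "bits (s (aval e s)) \<le> B" using ok_aval bits_le by auto
  then show ?case using Contents by (simp add: add_mult_distrib)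
next
  case (Op f a b)
  then have "bits (aval a s) \<le> B" "bits (aval b s) \<le> B" using ok_aval bits_le by auto
  then show ?case using Op by (simp add: add_mult_distrib)
qed (simp add: bits_le)

lemma hoare_Store:
  assumes "\<And>s. P s \<Longrightarrow> ok B a s \<and> ok B e s \<and> Q (s(aval a s := aval e s))"
    and "1 \<le> B" "nodes a + nodes e + 2 \<le> C"
  shows "hoare P (Store a e) (C * B) Q"
  unfolding hoare_def
proof (intro allI impI)
  fix s assume "P s"
  then have a: "ok B a s" and e: "ok B e s" and Q: "Q (s(aval a s := aval e s))" using assms(1) by auto
  have "acost a s + acost e s + bits (aval a s) + bits (aval e s) \<le> (nodes a + nodes e + 2) * B"
    using acost_le[OF a assms(2)] acost_le[OF e assms(2)] bits_le[OF ok_aval[OF a] assms(2)]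
      bits_le[OF ok_aval[OF e] assms(2)] by (simp add: add_mult_distrib)
  also have "\<dots> \<le> C * B" using assms(3) by (rule mult_le_mono1)
  finally show "\<exists>k t. exec (Store a e) s k t \<and> k \<le> C * B \<and> Q t" using exec.Store Q by blast
qed

text \<open>The tested expression is itself the variant. Each round costs the body and one test; the
  last \<open>C * B\<close> is the test that ends the loop.\<close>

lemma hoare_While:
  assumes I: "\<And>s. I s \<Longrightarrow> ok B b s" and B: "1 \<le> B" "nodes b + 1 \<le> C"
    and body: "\<And>r. 0 < r \<Longrightarrow> r \<le> N \<Longrightarrow>
      hoare (\<lambda>s. I s \<and> aval b s = r) c K (\<lambda>s. I s \<and> aval b s < r)"
  shows "hoare (\<lambda>s. I s \<and> aval b s \<le> N) (WhileNZ b c) (N * (K + C * B) + C * B) (\<lambda>s. I s \<and> aval b s = 0)"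
proof -
  have test: "acost b s + bits (aval b s) \<le> C * B" if "I s" for s
  proof -
    have "acost b s + bits (aval b s) \<le> (nodes b + 1) * B"
      using acost_le[OF I[OF that] B(1)] bits_le[OF ok_aval[OF I[OF that]] B(1)]
      by (simp add: add_mult_distrib)
    also have "\<dots> \<le> C * B" using B(2) by (rule mult_le_mono1)
    finally show ?thesis .
  qed
  have "\<exists>k t. exec (WhileNZ b c) s k t \<and> k \<le> r * (K + C * B) + C * B \<and> I t \<and> aval b t = 0"
    if "I s" "aval b s \<le> r" "r \<le> N" for s r
    using that
  proof (induction r arbitrary: s)
    case 0
    then have "exec (WhileNZ b c) s (acost b s + bits (aval b s)) s" by (intro exec.WhileFalse) simp
    then show ?case using test[OF 0(1)] 0 by auto
  next
    case (Suc r)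
    show ?case
    proof (cases "aval b s = 0")
      case True
      then have "exec (WhileNZ b c) s (acost b s + bits (aval b s)) s" by (rule exec.WhileFalse)
      then show ?thesis using test[OF Suc.prems(1)] Suc.prems True
        by (meson le_add2 order_trans)
    next
      case False
      obtain k1 s1 where 1: "exec c s k1 s1" "k1 \<le> K" "I s1" "aval b s1 < aval b s"
        using body[of "aval b s"] False Suc.prems unfolding hoare_def by auto
      obtain k2 t where 2: "exec (WhileNZ b c) s1 k2 t" "k2 \<le> r * (K + C * B) + C * B" "I t" "aval b t = 0"
        using Suc.IH[of s1] 1 Suc.prems by auto
      have "acost b s + bits (aval b s) + k1 + k2 \<le> Suc r * (K + C * B) + C * B"
        using test[OF Suc.prems(1)] 1(2) 2(2) by simp
      then show ?thesis using exec.WhileTrue[OF False 1(1) 2(1)] 2 by blast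
    qed
  qed
  then show ?thesis unfolding hoare_def by blast
qed

text \<open>
  The input fills all cells with small fixed addresses, so the other cells are addressed relative
  to \<open>n\<close>: first 11 variables, then a table with three indices of base \<open>n + 1\<close>.
\<close>

definition NV where "NV = Contents (Const 0)"
definition MV where "MV = Contents (Const 1)"
definition var where "var x = Op Add NV (Const (x + 2))"
definition V where "V x = Contents (var x)"
definition Ltr where "Ltr e = Contents (Op Add e (Const 2))"
definition tabA where
  "tabA a b c = Op Add (Op Add NV (Const 13))
     (Op Add (Op Mult (Op Add (Op Mult a (Op Add NV (Const 1))) b) (Op Add NV (Const 1))) c)"
definition Tab where "Tab a b c = Contents (tabA a b c)"

text \<open>The decrement precedes the body, which thus sees the values from the bound minus 1 down
  to 0 and can use them as indices.\<close>

definition loop :: "nat \<Rightarrow> aexp \<Rightarrow> com \<Rightarrow> com" where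
  "loop x e c = Seq (Store (var x) e)
     (WhileNZ (V x) (Seq (Store (var x) (Op Sub (V x) (Const 1))) c))"

text \<open>\<open>B\<close> bounds the bit length of all numbers handled: addresses are cubic in
  \<open>n\<close>, accumulated sums at most \<open>n^4 * 2^n\<close>, hence at most
  \<open>2^(5 * n)\<close>. The coefficients are generous.\<close>

locale ranking =
  fixes w :: word and m n B :: nat
  assumes n_def: "n = length w" and m: "1 \<le> m" "m \<le> n" and B_def: "B = 10 * n + 20"
begin

section \<open>Size bounds and memory layout\<close>

lemma B1: "1 \<le> B" by (simp add: B_def)

lemma n_pos: "1 \<le> n" using m by simp

lemma cube_less: "x \<le> 20 * (n + 1) ^ 3 \<Longrightarrow> x < 2 ^ B"
proof -
  assume x: "x \<le> 20 * (n + 1) ^ 3"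
  have "n + 1 \<le> 2 ^ n" using less_exp[of n] by linarith
  then have "(n + 1) ^ 3 \<le> (2 ^ n) ^ 3" by (rule power_mono) simp
  also have "\<dots> = 2 ^ (3 * n)" by (simp add: power_mult[symmetric] mult.commute)
  also have "\<dots> \<le> 2 ^ (10 * n)" by simp
  finally have "20 * (n + 1) ^ 3 \<le> 20 * (2 ^ (10 * n) :: nat)" by (rule mult_le_mono2)
  also have "\<dots> < 2 ^ 20 * (2 ^ (10 * n) :: nat)" by simp
  finally have "20 * (n + 1) ^ 3 < 2 ^ 20 * (2 ^ (10 * n) :: nat)" .
  then show ?thesis using x by (simp add: B_def power_add mult.commute)
qed

lemma lin_less: "x \<le> 20 * n + 20 \<Longrightarrow> x < 2 ^ B"
proof -
  have "n + 1 \<le> (n + 1) ^ 3" by (simp add: power3_eq_cube)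
  moreover assume "x \<le> 20 * n + 20"
  ultimately show ?thesis by (intro cube_less) simp
qed

definition av :: "nat \<Rightarrow> nat" where "av x = n + 2 + x"
definition tb :: "nat \<Rightarrow> nat \<Rightarrow> nat \<Rightarrow> nat" where
  "tb t i j = n + 13 + ((t * (n + 1) + i) * (n + 1) + j)"
definition inp :: "memory \<Rightarrow> bool" where
  "inp s \<longleftrightarrow> s 0 = n \<and> s 1 = m \<and> (\<forall>i<n. s (i + 2) = of_bool (w ! i))"

lemma av_eq [simp]: "av x = av y \<longleftrightarrow> x = y" by (simp add: av_def)

lemma av_neq_tb [simp]: "x < 11 \<Longrightarrow> av x \<noteq> tb t i j" "x < 11 \<Longrightarrow> tb t i j \<noteq> av x"
  by (auto simp: av_def tb_def)

text \<open>The address is a numeral in base \<open>n + 1\<close>. The digit \<open>n\<close>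
  occurs, for the failure column and for the counts of gcd values.\<close>

lemma tb_eq [simp]:
  assumes "i \<le> n" "j \<le> n" "i' \<le> n" "j' \<le> n"
  shows "tb t i j = tb t' i' j' \<longleftrightarrow> t = t' \<and> i = i' \<and> j = j'"
proof -
  have digit: "a * (n + 1) + b = a' * (n + 1) + b' \<longleftrightarrow> a = a' \<and> b = b'"
    if "b \<le> n" "b' \<le> n" for a a' b b' :: nat
  proof
    assume eq: "a * (n + 1) + b = a' * (n + 1) + b'"
    have "(a * (n + 1) + b) div (n + 1) = a" "(a' * (n + 1) + b') div (n + 1) = a'"
      using that by (simp_all del: add_Suc_right)
    then show "a = a' \<and> b = b'" using eq by auto
  qed simp
  show ?thesis unfolding tb_def add_left_cancel digit[OF assms(2,4)] digit[OF assms(1,3)] by simp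
qed

lemma tb_less:
  assumes "t \<le> n" "i \<le> n" "j \<le> n"
  shows "tb t i j < 2 ^ B"
proof (rule cube_less)
  have "t * (n + 1) + i \<le> n * (n + 1) + n" using assms by (intro add_mono mult_le_mono) auto
  then have "(t * (n + 1) + i) * (n + 1) + j \<le> (n * (n + 1) + n) * (n + 1) + n"
    using assms by (intro add_mono mult_le_mono) auto
  then show "tb t i j \<le> 20 * (n + 1) ^ 3"
    by (simp add: tb_def power3_eq_cube algebra_simps)
qed

lemma inp_upd [simp]: "inp (s(av x := v)) = inp s" "inp (s(tb t i j := v)) = inp s"
  by (auto simp: inp_def av_def tb_def)

lemma aval_NV [simp]: "inp s \<Longrightarrow> aval NV s = n" by (simp add: NV_def inp_def)
lemma aval_MV [simp]: "inp s \<Longrightarrow> aval MV s = m" by (simp add: MV_def inp_def)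
lemma aval_var [simp]: "inp s \<Longrightarrow> aval (var x) s = av x" by (simp add: var_def av_def)
lemma aval_V [simp]: "inp s \<Longrightarrow> aval (V x) s = s (av x)" by (simp add: V_def)
lemma aval_Ltr [simp]: "inp s \<Longrightarrow> aval e s < n \<Longrightarrow> aval (Ltr e) s = of_bool (w ! aval e s)"
  by (simp add: Ltr_def inp_def)
lemma aval_tabA [simp]: "inp s \<Longrightarrow> aval (tabA a b c) s = tb (aval a s) (aval b s) (aval c s)"
  by (simp add: tabA_def tb_def)
lemma aval_Tab [simp]: "inp s \<Longrightarrow> aval (Tab a b c) s = s (tb (aval a s) (aval b s) (aval c s))"
  by (simp add: Tab_def)

lemma ok_NV [simp]: "inp s \<Longrightarrow> ok B NV s" using lin_less[of n] by (simp add: NV_def inp_def)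
lemma ok_MV [simp]: "inp s \<Longrightarrow> ok B MV s"
  using lin_less[of m] lin_less[of 1] m by (simp add: MV_def inp_def)
lemma ok_var [simp]: "inp s \<Longrightarrow> x < 11 \<Longrightarrow> ok B (var x) s"
  using lin_less[of "x + 2"] lin_less[of "n + (x + 2)"] by (simp add: var_def)
lemma ok_V [simp]: "inp s \<Longrightarrow> x < 11 \<Longrightarrow> ok B (V x) s \<longleftrightarrow> s (av x) < 2 ^ B"
  by (simp add: V_def)
lemma ok_Ltr [simp]: "inp s \<Longrightarrow> ok B e s \<Longrightarrow> aval e s < n \<Longrightarrow> ok B (Ltr e) s"
  using lin_less[of 2] lin_less[of "aval e s + 2"] lin_less[of 1] lin_less[of 0]
  by (simp add: Ltr_def inp_def)
lemma ok_tabA [simp]: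
  assumes "inp s" "ok B a s" "ok B b s" "ok B c s" "aval a s \<le> n" "aval b s \<le> n" "aval c s \<le> n"
  shows "ok B (tabA a b c) s"
proof -
  have "tb (aval a s) (aval b s) (aval c s) < 2 ^ B" using assms by (intro tb_less)
  then have lt: "x < 2 ^ B" if "x \<le> (aval a s * (n + 1) + aval b s) * (n + 1) + aval c s" for x
    using that by (simp add: tb_def)
  have "aval a s * (n + 1) + aval b s \<le> (aval a s * (n + 1) + aval b s) * (n + 1)" by simp
  then show ?thesis
    using assms lin_less[of 13] lin_less[of "n + 13"] lin_less[of 1] lin_less[of "n + 1"]
      \<open>tb _ _ _ < 2 ^ B\<close> lt by (simp add: tabA_def tb_def)
qed
lemma ok_Tab [simp]:
  assumes "inp s" "ok B a s" "ok B b s" "ok B c s" "aval a s \<le> n" "aval b s \<le> n" "aval c s \<le> n"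
    and "s (tb (aval a s) (aval b s) (aval c s)) < 2 ^ B"
  shows "ok B (Tab a b c) s"
  using assms by (simp add: Tab_def)

text \<open>Bounds the cost of one assignment: at most 998 nodes in its expressions, and two further
  \<open>bits\<close> terms for the store itself.\<close>

definition U :: nat where "U = 1000 * B"

lemmas nodes_defs = NV_def MV_def var_def V_def Ltr_def tabA_def Tab_def

lemma hoare_assign:
  assumes step: "\<And>s. P s \<Longrightarrow> ok B a s \<and> ok B e s \<and> Q (s(aval a s := aval e s))"
    and size: "nodes a + nodes e \<le> 998"
  shows "hoare P (Store a e) U Q"
  unfolding U_def
proof (rule hoare_Store[OF step B1])
  show "nodes a + nodes e + 2 \<le> 1000" using size by linarith
qed

text \<open>\<open>J k\<close> is the invariant with \<open>k\<close> rounds left and must not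
  depend on the counter. A round pays for decrement, body and test; the surplus covers the initial
  store and the final test.\<close>

lemma hoare_loop:
  assumes inp: "\<And>k s. J k s \<Longrightarrow> inp s"
    and indep: "\<And>k s v. J k s \<Longrightarrow> J k (s(av x := v))"
    and e: "\<And>s. inp s \<Longrightarrow> ok B e s \<and> aval e s = N" "nodes e \<le> 100" "N \<le> n" "x < 11"
    and body: "\<And>k. k < N \<Longrightarrow>
      hoare (\<lambda>s. J (Suc k) s \<and> s (av x) = k) c K (\<lambda>s. J k s \<and> s (av x) = k)"
  shows "hoare (J N) (loop x e c) ((n + 1) * (K + 3 * U)) (J 0)"
proof -
  have nodes: "nodes (var x) = 6" "nodes (V x) = 8" by (simp_all add: nodes_defs)
  have small: "k < 2 ^ B" if "k \<le> n" for k using that by (intro lin_less) simp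
  let ?I = "\<lambda>s. J (s (av x)) s \<and> s (av x) \<le> N"
  have init: "hoare (J N) (Store (var x) e) U (\<lambda>s. ?I s \<and> aval (V x) s \<le> N)"
    by (rule hoare_assign) (use e inp indep nodes in \<open>auto dest: inp\<close>)
  have "hoare (\<lambda>s. ?I s \<and> aval (V x) s \<le> N)
     (WhileNZ (V x) (Seq (Store (var x) (Op Sub (V x) (Const 1))) c))
     (N * (U + K + 1000 * B) + 1000 * B) (\<lambda>s. ?I s \<and> aval (V x) s = 0)"
  proof (rule hoare_While)
    fix s assume s: "?I s"
    then have "inp s" using inp by blast
    then show "ok B (V x) s" using s e(3,4) small by simp
  next
    fix r assume r: "0 < r" "r \<le> N"
    have "hoare (\<lambda>s. ?I s \<and> aval (V x) s = r) (Store (var x) (Op Sub (V x) (Const 1))) U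
        (\<lambda>s. J (Suc (r - 1)) s \<and> s (av x) = r - 1)"
    proof (rule hoare_assign)
      fix s assume s: "?I s \<and> aval (V x) s = r"
      then have i: "inp s" using inp by blast
      then show "ok B (var x) s \<and> ok B (Op Sub (V x) (Const 1)) s \<and>
          J (Suc (r - 1)) (s(aval (var x) s := aval (Op Sub (V x) (Const 1)) s)) \<and>
          (s(aval (var x) s := aval (Op Sub (V x) (Const 1)) s)) (av x) = r - 1"
        using s r e(3,4) small[of r] small[of "r - 1"] small[of 1] n_pos indep by auto
    qed (simp add: nodes)
    moreover have "hoare (\<lambda>s. J (Suc (r - 1)) s \<and> s (av x) = r - 1) c K (\<lambda>s. ?I s \<and> aval (V x) s < r)"
      by (rule hoare_conseq[OF body[of "r - 1"]]) (use r in \<open>auto dest: inp\<close>)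
    ultimately show "hoare (\<lambda>s. ?I s \<and> aval (V x) s = r)
        (Seq (Store (var x) (Op Sub (V x) (Const 1))) c) (U + K) (\<lambda>s. ?I s \<and> aval (V x) s < r)"
      by (rule hoare_Seq)
  qed (use B1 nodes in simp_all)
  note hoare_Seq[OF init this]
  then show ?thesis unfolding loop_def
  proof (rule hoare_conseq)
    have "N * (U + K + U) \<le> n * (K + 3 * U)" using e(3) by (intro mult_le_mono) auto
    then show "U + (N * (U + K + 1000 * B) + 1000 * B) \<le> (n + 1) * (K + 3 * U)"
      by (simp add: U_def)
  next
    fix s assume s: "?I s \<and> aval (V x) s = 0"
    then have "inp s" using inp by blast
    then have "s (av x) = 0" using s by simp
    then show "J 0 s" using s by metis
  qed
qed

end

section \<open>Dynamic programming over all starting states\<close>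

text \<open>The successor modulo \<open>n\<close>, the machine having division but no
  remainder.\<close>

definition nxt where
  "nxt e = Op Sub (Op Add e (Const 1)) (Op Mult (Op Div (Op Add e (Const 1)) NV) NV)"
definition low_zero where "low_zero f = (if f then nxt (V 7) else Const 0)"
text \<open>Letters are stored as 0 and 1, so the case distinctions of \<open>walks\<close> become
  products and an entry is computed by a single assignment.\<close>

definition low_one where "low_one f = (if f then Op Mult (Ltr (V 7)) (nxt (V 7)) else Const 0)"
definition low_ok where "low_ok f = (if f then Op Sub (Const 1) (Ltr (V 7)) else Const 1)"
definition up_one where "up_one = Op Mult (Ltr (V 8)) (Op Add (V 8) (Const 1))"
text \<open>
  Variable 6 is \<open>m - t\<close> for the number \<open>t\<close> of letters still to be read, variables 7 and 8 are the states of
  the two automata and 4 and 5 the states to be reached in the end. The column \<open>n\<close> of the table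
  remains 0; it stands for the failure of the second automaton.
\<close>

definition step where
  "step f = Store (tabA (V 6) (V 7) (V 8))
     (Op Add
       (Op Mult (low_ok f) (Tab (Op Add (V 6) (Const 1)) (low_zero f) up_one))
       (Op Mult (Op Sub (Const 1) (Ltr (V 8)))
         (Tab (Op Add (V 6) (Const 1)) (low_one f) (Op Add (V 8) (Const 1)))))"
definition acc_var :: "bool \<Rightarrow> nat" where "acc_var f = (if f then 10 else 9)"
text \<open>The table entries with second index \<open>n\<close> and third index 0 count the \<open>k\<close> with a given \<open>gcd k m\<close>.\<close>

definition accumulate where
  "accumulate f = Store (var (acc_var f)) (Op Add (V (acc_var f))
     (Op Mult (Tab (Op Sub MV (V 6)) NV (Const 0)) (Tab (V 6) (V 4) (V 5))))"
definition layers where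
  "layers f = loop 6 MV (Seq (loop 7 NV (loop 8 NV (step f))) (accumulate f))"
text \<open>The 1 seeds the layer with no letters left to read. It is erased afterwards because the
  next start expects this layer to be 0; the other layers are overwritten.\<close>

definition all_starts where
  "all_starts f = loop 4 NV (loop 5 NV
     (Seq (Store (tabA MV (V 4) (V 5)) (Const 1))
       (Seq (layers f) (Store (tabA MV (V 4) (V 5)) (Const 0)))))"

context ranking
begin

lemma pow_less:
  fixes x :: nat
  assumes "x \<le> 2 ^ (10 * n + 19)"
  shows "x < 2 ^ B"
proof -
  note assms
  also have "(2::nat) ^ (10 * n + 19) < 2 ^ B" unfolding B_def by (rule power_strict_increasing) auto
  finally show ?thesis .
qed

definition \<phi> :: "nat \<Rightarrow> nat" where "\<phi> t = card {q \<in> {1..m}. gcd q m = t}"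

lemma \<phi>_le: "\<phi> t \<le> n"
proof -
  have "\<phi> t \<le> card {1..m}" unfolding \<phi>_def by (rule card_mono) auto
  then show ?thesis using m by simp
qed

definition Base :: "memory \<Rightarrow> bool" where
  "Base s \<longleftrightarrow> inp s \<and> (\<forall>t\<le>m. s (tb t n 0) = \<phi> t) \<and> (\<forall>t\<le>m. \<forall>i<n. s (tb t i n) = 0)"

text \<open>\<open>D\<close> is the set of table entries already correct, \<open>a\<close> the
  accumulator in use, and \<open>b\<close> that of the other pass, carried along unchanged.\<close>

definition St :: "bool \<Rightarrow> nat \<Rightarrow> nat \<Rightarrow> (nat \<times> nat \<times> nat) set \<Rightarrow> nat \<Rightarrow> nat \<Rightarrow> memory \<Rightarrow> bool" where
  "St f i0 j0 D a b s \<longleftrightarrow> Base s \<and> s (av 4) = i0 \<and> s (av 5) = j0 \<and>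
     s (av (acc_var f)) = a \<and> s (av (acc_var (\<not> f))) = b \<and>
     (\<forall>t i j. (t, i, j) \<in> D \<longrightarrow> s (tb t i j) = walks f w i0 j0 (m - t) i j)"

lemma acc_var: "acc_var f < 11" "acc_var f \<noteq> acc_var (\<not> f)" "acc_var f \<ge> 9"
  by (auto simp: acc_var_def)

lemma acc_var_neq [simp]:
  "acc_var f \<noteq> 4" "acc_var f \<noteq> 5" "acc_var f \<noteq> 6" "acc_var f \<noteq> 7" "acc_var f \<noteq> 8"
  "acc_var f \<noteq> acc_var (\<not> f)" "acc_var (\<not> f) \<noteq> acc_var f" "acc_var f < 11"
  "4 \<noteq> acc_var f" "5 \<noteq> acc_var f" "6 \<noteq> acc_var f" "7 \<noteq> acc_var f" "8 \<noteq> acc_var f"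
  by (auto simp: acc_var_def)

lemma Base_inp: "Base s \<Longrightarrow> inp s" by (simp add: Base_def)
lemma St_inp: "St f i0 j0 D a b s \<Longrightarrow> inp s" by (simp add: St_def Base_def)

lemma Base_var [simp]: "x < 11 \<Longrightarrow> Base (s(av x := v)) = Base s"
  by (simp add: Base_def)

lemma Base_tab [simp]: "i < n \<Longrightarrow> j < n \<Longrightarrow> Base (s(tb t i j := v)) = Base s"
  by (auto simp: Base_def)

lemma St_var: "St f i0 j0 D a b s \<Longrightarrow> x \<in> {6, 7, 8} \<Longrightarrow> St f i0 j0 D a b (s(av x := v))"
  by (auto simp: St_def acc_var_def)

lemma aval_nxt [simp]: "inp s \<Longrightarrow> aval (nxt e) s = Suc (aval e s) mod n"
  by (simp add: nxt_def minus_div_mult_eq_mod)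

lemma ok_nxt [simp]: "inp s \<Longrightarrow> ok B e s \<Longrightarrow> aval e s < n \<Longrightarrow> ok B (nxt e) s"
proof -
  assume s: "inp s" "ok B e s" "aval e s < n"
  have "Suc (aval e s) div n * n \<le> Suc (aval e s)" by simp
  then have "Suc (aval e s) div n * n < 2 ^ B" "Suc (aval e s) < 2 ^ B"
      "Suc (aval e s) div n < 2 ^ B" "Suc (aval e s) - Suc (aval e s) div n * n < 2 ^ B" "1 < (2::nat) ^ B"
    using s(3) div_le_dividend[of "Suc (aval e s)" n] by (intro lin_less; linarith)+
  then show ?thesis using s by (simp add: nxt_def)
qed

lemma walks_at_n: "j0 < n \<Longrightarrow> walks f w i0 j0 t i n = 0"
  by (cases t) (auto simp: n_def)

lemma hoare_step:
  assumes ij: "i0 < n" "j0 < n" "\<tau> < m" "i < n" "j < n"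
    and D: "\<And>i' j'. i' < n \<Longrightarrow> j' < n \<Longrightarrow> (Suc \<tau>, i', j') \<in> D"
    "D \<subseteq> {..m} \<times> {..<n} \<times> {..<n}"
  shows "hoare (\<lambda>s. St f i0 j0 D a b s \<and> s (av 6) = \<tau> \<and> s (av 7) = i \<and> s (av 8) = j) (step f) U
    (\<lambda>s. St f i0 j0 (insert (\<tau>, i, j) D) a b s \<and> s (av 6) = \<tau> \<and> s (av 7) = i \<and> s (av 8) = j)"
  unfolding step_def
proof (rule hoare_assign)
  fix s assume s: "St f i0 j0 D a b s \<and> s (av 6) = \<tau> \<and> s (av 7) = i \<and> s (av 8) = j"
  then have inp: "inp s" and v: "s (av 6) = \<tau>" "s (av 7) = i" "s (av 8) = j" using St_inp by auto
  have n: "length w = n" "0 < n" using n_def n_pos by auto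
  have small: "x < 2 ^ B" if "x \<le> n + 1" for x using that by (intro lin_less) simp
  note small' = small[of \<tau>] small[of i] small[of j] small[of "Suc \<tau>"] small[of "Suc j"] small[of 0] small[of 1]
  let ?l0 = "if f then Suc i mod n else 0" and ?l1 = "if f \<and> w ! i then Suc i mod n else 0"
  let ?u1 = "if w ! j then Suc j else 0"
  have l: "?l0 < n" "?l1 < n" "?u1 \<le> n" using ij n(2) by auto
  \<comment> \<open>The recursion may ask for third index \<open>n\<close>; the 0 stored there is
    the right value by \<open>walks_at_n\<close>.\<close>
  have W: "s (tb (Suc \<tau>) i' j') = walks f w i0 j0 (m - Suc \<tau>) i' j'" if "i' < n" "j' \<le> n" for i' j'
  proof (cases "j' = n")
    case True
    then show ?thesis using s that ij walks_at_n[OF ij(2)] by (simp add: St_def Base_def)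
  next
    case False
    then show ?thesis using s that D(1)[of i' j'] by (simp add: St_def)
  qed
  have Wle: "walks f w i0 j0 (m - Suc \<tau>) i' j' \<le> 2 ^ n" for i' j'
    using walks_le[of f w i0 j0 "m - Suc \<tau>" i' j'] power_increasing[of "m - Suc \<tau>" n "2::nat"] m(2)
    by (meson diff_le_self le_trans one_le_numeral)
  have vals: "aval (low_zero f) s = ?l0" "aval (low_one f) s = ?l1"
      "aval (low_ok f) s = 1 - of_bool (f \<and> w ! i)" "aval up_one s = ?u1"
    using inp v ij by (simp_all add: low_zero_def low_one_def low_ok_def up_one_def)
  have oks: "ok B (low_zero f) s" "ok B (low_one f) s" "ok B (low_ok f) s" "ok B up_one s"
    using inp v ij small' small[of "Suc i mod n"] mod_le_divisor[OF n(2), of "Suc i"] m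
    by (simp_all add: low_zero_def low_one_def low_ok_def up_one_def)
  let ?T1 = "Tab (Op Add (V 6) (Const 1)) (low_zero f) up_one"
  let ?T2 = "Tab (Op Add (V 6) (Const 1)) (low_one f) (Op Add (V 8) (Const 1))"
  let ?w1 = "walks f w i0 j0 (m - Suc \<tau>) ?l0 ?u1" and ?w2 = "walks f w i0 j0 (m - Suc \<tau>) ?l1 (Suc j)"
  have T: "aval ?T1 s = ?w1" "aval ?T2 s = ?w2"
    using inp v vals W[OF l(1,3)] W[OF l(2), of "Suc j"] ij by simp_all
  have big: "x < 2 ^ B" if "x \<le> 2 ^ n + 2 ^ n" for x :: nat
  proof (rule pow_less)
    have "(2::nat) ^ n + 2 ^ n = 2 ^ (n + 1)" by simp
    also have "\<dots> \<le> 2 ^ (10 * n + 19)" by (rule power_increasing) auto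
    finally show "x \<le> 2 ^ (10 * n + 19)" using that by simp
  qed
  have okT: "ok B ?T1 s" "ok B ?T2 s"
    using inp v vals oks l W[OF l(1,3)] W[OF l(2), of "Suc j"] ij small' m
      big[of ?w1] big[of ?w2] Wle[of ?l0 ?u1] Wle[of ?l1 "Suc j"]
    by (auto intro!: ok_Tab)
  let ?c1 = "1 - of_bool (f \<and> w ! i) :: nat" and ?c2 = "1 - of_bool (w ! j) :: nat"
  let ?e = "Op Add (Op Mult (low_ok f) ?T1) (Op Mult (Op Sub (Const 1) (Ltr (V 8))) ?T2)"
  have prod: "?c1 * ?w1 \<le> 2 ^ n" "?c2 * ?w2 \<le> 2 ^ n"
  proof -
    have le: "(1 - a) * x \<le> 2 ^ n" if "x \<le> 2 ^ n" for a x :: nat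
      using mult_le_mono[OF diff_le_self[of 1 a] that] by simp
    show "?c1 * ?w1 \<le> 2 ^ n" "?c2 * ?w2 \<le> 2 ^ n" using le[OF Wle] by blast+
  qed
  have L: "aval (Ltr (V 8)) s = of_bool (w ! j)" "ok B (Ltr (V 8)) s"
    using inp v ij small' by simp_all
  have val: "aval ?e s = ?c1 * ?w1 + ?c2 * ?w2"
    by (simp only: aval.simps apply_op.simps T vals L)
  also have "\<dots> = walks f w i0 j0 (Suc (m - Suc \<tau>)) i j"
    using ij(5) n(1) by (simp only: walks.simps if_True)
  also have "Suc (m - Suc \<tau>) = m - \<tau>" using ij by simp
  finally have fin: "aval ?e s = walks f w i0 j0 (m - \<tau>) i j" .
  have oke: "ok B ?e s"
    unfolding ok.simps aval.simps apply_op.simps T vals L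
  proof (intro conjI)
    show "1 < (2::nat) ^ B" "?c2 < 2 ^ B" by (rule small; simp)+
    show "?c1 * ?w1 < 2 ^ B" "?c2 * ?w2 < 2 ^ B" "?c1 * ?w1 + ?c2 * ?w2 < 2 ^ B"
      by (rule big[OF le_trans[OF prod(1) le_add1]], rule big[OF le_trans[OF prod(2) le_add1]],
          rule big[OF add_mono[OF prod]])
  qed (fact oks(3) okT L(2))+
  have addr: "aval (tabA (V 6) (V 7) (V 8)) s = tb \<tau> i j" using inp v by simp
  have "ok B (tabA (V 6) (V 7) (V 8)) s" using inp v ij m small' by simp
  moreover have "St f i0 j0 (insert (\<tau>, i, j) D) a b (s(tb \<tau> i j := walks f w i0 j0 (m - \<tau>) i j))"
  proof -
    have "tb t i' j' = tb \<tau> i j \<longleftrightarrow> t = \<tau> \<and> i' = i \<and> j' = j" if "(t, i', j') \<in> D" for t i' j'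
      using that D(2) ij by (intro tb_eq) auto
    then show ?thesis using s ij acc_var(1) by (auto simp: St_def)
  qed
  ultimately show "ok B (tabA (V 6) (V 7) (V 8)) s \<and> ok B ?e s \<and>
      St f i0 j0 (insert (\<tau>, i, j) D) a b (s(aval (tabA (V 6) (V 7) (V 8)) s := aval ?e s)) \<and>
      (s(aval (tabA (V 6) (V 7) (V 8)) s := aval ?e s)) (av 6) = \<tau> \<and>
      (s(aval (tabA (V 6) (V 7) (V 8)) s := aval ?e s)) (av 7) = i \<and>
      (s(aval (tabA (V 6) (V 7) (V 8)) s := aval ?e s)) (av 8) = j"
    unfolding addr fin using oke v by simp
qed (simp add: nodes_defs nxt_def low_zero_def low_one_def low_ok_def up_one_def)

text \<open>Finished regions for the loops over layers, rows and entries. All three loops count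
  down, so the finished indices are the large ones.\<close>

definition DL :: "nat \<Rightarrow> (nat \<times> nat \<times> nat) set" where
  "DL \<tau> = {(t, i, j). \<tau> \<le> t \<and> t \<le> m \<and> i < n \<and> j < n}"
definition DR :: "nat \<Rightarrow> nat \<Rightarrow> (nat \<times> nat \<times> nat) set" where
  "DR \<tau> k = DL (Suc \<tau>) \<union> {(t, i, j). t = \<tau> \<and> k \<le> i \<and> i < n \<and> j < n}"
definition DC :: "nat \<Rightarrow> nat \<Rightarrow> nat \<Rightarrow> (nat \<times> nat \<times> nat) set" where
  "DC \<tau> i k = DR \<tau> (Suc i) \<union> {(t, i', j). t = \<tau> \<and> i' = i \<and> k \<le> j \<and> j < n}"

text \<open>The weight is the number of summands of Burnside's sum whose gcd is the length
  \<open>m - \<tau>\<close> of the walks in this layer.\<close>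

definition contrib :: "bool \<Rightarrow> nat \<Rightarrow> nat \<Rightarrow> nat \<Rightarrow> nat" where
  "contrib f i0 j0 \<tau> = \<phi> (m - \<tau>) * walks f w i0 j0 (m - \<tau>) i0 j0"
definition total :: "bool \<Rightarrow> nat \<Rightarrow> nat \<Rightarrow> nat" where
  "total f i0 j0 = (\<Sum>\<tau><m. contrib f i0 j0 \<tau>)"
definition grand :: "bool \<Rightarrow> nat" where
  "grand f = (\<Sum>i0<n. \<Sum>j0<n. total f i0 j0)"

definition K_row where "K_row = (n + 1) * (U + 3 * U)"
definition K_layer where "K_layer = (n + 1) * (K_row + 3 * U)"
definition K_layers where "K_layers = (n + 1) * ((K_layer + U) + 3 * U)"
definition K_starts where
  "K_starts = (n + 1) * ((n + 1) * ((U + (K_layers + U)) + 3 * U) + 3 * U)"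

lemma hoare_row:
  assumes "i0 < n" "j0 < n" "\<tau> < m" "i < n"
  shows "hoare (\<lambda>s. St f i0 j0 (DR \<tau> (Suc i)) a b s \<and> s (av 6) = \<tau> \<and> s (av 7) = i)
    (loop 8 NV (step f)) K_row
    (\<lambda>s. St f i0 j0 (DR \<tau> i) a b s \<and> s (av 6) = \<tau> \<and> s (av 7) = i)"
proof -
  let ?J = "\<lambda>k s. St f i0 j0 (DC \<tau> i k) a b s \<and> s (av 6) = \<tau> \<and> s (av 7) = i"
  have D: "DC \<tau> i n = DR \<tau> (Suc i)" "DC \<tau> i 0 = DR \<tau> i"
    using assms(4) by (auto simp: DC_def DR_def Suc_le_eq le_less)
  have "hoare (?J n) (loop 8 NV (step f)) ((n + 1) * (U + 3 * U)) (?J 0)"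
  proof (rule hoare_loop)
    fix k assume k: "k < n"
    have "insert (\<tau>, i, k) (DC \<tau> i (Suc k)) = DC \<tau> i k" using k by (auto simp: DC_def Suc_le_eq le_less)
    moreover have "DC \<tau> i (Suc k) \<subseteq> {..m} \<times> {..<n} \<times> {..<n}"
      using assms by (auto simp: DC_def DR_def DL_def)
    moreover have "(Suc \<tau>, i', j') \<in> DC \<tau> i (Suc k)" if "i' < n" "j' < n" for i' j'
      using assms that by (auto simp: DC_def DR_def DL_def)
    ultimately show "hoare (\<lambda>s. ?J (Suc k) s \<and> s (av 8) = k) (step f) U (\<lambda>s. ?J k s \<and> s (av 8) = k)"
      using hoare_step[of i0 j0 \<tau> i k "DC \<tau> i (Suc k)" f a b] assms k by simp
  next
    fix k s v assume "?J k s"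
    then show "?J k (s(av 8 := v))" by (auto intro: St_var)
  qed (auto dest: St_inp simp: NV_def[THEN arg_cong[of _ _ nodes]])
  then show ?thesis unfolding D K_row_def .
qed

lemma hoare_layer:
  assumes "i0 < n" "j0 < n" "\<tau> < m"
  shows "hoare (\<lambda>s. St f i0 j0 (DL (Suc \<tau>)) a b s \<and> s (av 6) = \<tau>)
    (loop 7 NV (loop 8 NV (step f))) K_layer
    (\<lambda>s. St f i0 j0 (DL \<tau>) a b s \<and> s (av 6) = \<tau>)"
proof -
  let ?J = "\<lambda>k s. St f i0 j0 (DR \<tau> k) a b s \<and> s (av 6) = \<tau>"
  have D: "DR \<tau> n = DL (Suc \<tau>)" "DR \<tau> 0 = DL \<tau>"
    using assms(3) by (auto simp: DR_def DL_def)
  have "hoare (?J n) (loop 7 NV (loop 8 NV (step f))) ((n + 1) * (K_row + 3 * U)) (?J 0)"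
  proof (rule hoare_loop)
    fix k assume k: "k < n"
    show "hoare (\<lambda>s. ?J (Suc k) s \<and> s (av 7) = k) (loop 8 NV (step f)) K_row
        (\<lambda>s. ?J k s \<and> s (av 7) = k)"
      using hoare_row[OF assms k, of f a b] by (simp only: conj_assoc)
  next
    fix k s v assume "?J k s"
    then show "?J k (s(av 7 := v))" by (auto intro: St_var)
  qed (auto dest: St_inp simp: NV_def[THEN arg_cong[of _ _ nodes]])
  then show ?thesis unfolding D K_layer_def .
qed

lemma contrib_le: "contrib f i0 j0 \<tau> \<le> n * 2 ^ n"
proof -
  have "walks f w i0 j0 (m - \<tau>) i0 j0 \<le> 2 ^ (m - \<tau>)" by (rule walks_le)
  also have "\<dots> \<le> 2 ^ n" using m by (intro power_increasing) auto
  finally show ?thesis unfolding contrib_def using \<phi>_le by (intro mult_le_mono)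
qed

lemma n_pow: "n \<le> 2 ^ n"
  using less_exp[of n] by simp

lemma hoare_accumulate:
  assumes "i0 < n" "j0 < n" "\<tau> < m" "(\<tau>, i0, j0) \<in> D" "D \<subseteq> {..m} \<times> {..<n} \<times> {..<n}"
    and a: "a + contrib f i0 j0 \<tau> \<le> 2 ^ (10 * n + 17)"
  shows "hoare (\<lambda>s. St f i0 j0 D a b s \<and> s (av 6) = \<tau>) (accumulate f) U
    (\<lambda>s. St f i0 j0 D (a + contrib f i0 j0 \<tau>) b s \<and> s (av 6) = \<tau>)"
  unfolding accumulate_def
proof (rule hoare_assign)
  fix s assume s: "St f i0 j0 D a b s \<and> s (av 6) = \<tau>"
  then have inp: "inp s" and v: "s (av 6) = \<tau>" "s (av 4) = i0" "s (av 5) = j0" "s (av (acc_var f)) = a"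
    using St_inp by (auto simp: St_def)
  have small: "x < 2 ^ B" if "x \<le> n" for x using that by (intro lin_less) simp
  have big: "x < 2 ^ B" if "x \<le> 2 ^ (10 * n + 17)" for x :: nat
  proof (rule pow_less)
    have "(2::nat) ^ (10 * n + 17) \<le> 2 ^ (10 * n + 19)" by (rule power_increasing) auto
    then show "x \<le> 2 ^ (10 * n + 19)" using that by (rule order_trans[rotated])
  qed
  have phi: "s (tb (m - \<tau>) n 0) = \<phi> (m - \<tau>)" using s by (simp add: St_def Base_def)
  have wal: "s (tb \<tau> i0 j0) = walks f w i0 j0 (m - \<tau>) i0 j0" using s assms(4) by (simp add: St_def)
  have wal_le: "walks f w i0 j0 (m - \<tau>) i0 j0 < 2 ^ B"
  proof (rule pow_less)
    have "walks f w i0 j0 (m - \<tau>) i0 j0 \<le> 2 ^ (m - \<tau>)" by (rule walks_le)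
    also have "\<dots> \<le> 2 ^ (10 * n + 19)" using m by (intro power_increasing) auto
    finally show "walks f w i0 j0 (m - \<tau>) i0 j0 \<le> 2 ^ (10 * n + 19)" .
  qed
  let ?P = "Tab (Op Sub MV (V 6)) NV (Const 0)" and ?W = "Tab (V 6) (V 4) (V 5)"
  have vals: "aval ?P s = \<phi> (m - \<tau>)" "aval ?W s = walks f w i0 j0 (m - \<tau>) i0 j0"
    using inp v phi wal by simp_all
  have oks: "ok B ?P s" "ok B ?W s"
    using inp v phi wal wal_le assms m small[of \<tau>] small[of i0] small[of j0] small[of "m - \<tau>"]
      small[OF \<phi>_le] small[of 0] by (auto intro!: ok_Tab)
  let ?e = "Op Add (V (acc_var f)) (Op Mult ?P ?W)"
  have val: "aval ?e s = a + contrib f i0 j0 \<tau>" using vals inp v acc_var by (simp add: contrib_def)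
  have "ok B ?e s"
    using oks inp v acc_var(1) big[of a] big[of "contrib f i0 j0 \<tau>"] big[OF a] a
    by (simp add: vals contrib_def del: aval_Tab)
  moreover have "St f i0 j0 D (a + contrib f i0 j0 \<tau>) b (s(av (acc_var f) := a + contrib f i0 j0 \<tau>))"
    using s by (simp add: St_def)
  ultimately show "ok B (var (acc_var f)) s \<and> ok B ?e s \<and>
      St f i0 j0 D (a + contrib f i0 j0 \<tau>) b (s(aval (var (acc_var f)) s := aval ?e s)) \<and>
      (s(aval (var (acc_var f)) s := aval ?e s)) (av 6) = \<tau>"
    unfolding val using inp v by simp
qed (simp add: nodes_defs)

lemma hoare_layers:
  assumes "i0 < n" "j0 < n" and a: "a + total f i0 j0 \<le> 2 ^ (10 * n + 17)"
  shows "hoare (St f i0 j0 (DL m) a b) (layers f) K_layers (St f i0 j0 (DL 0) (a + total f i0 j0) b)"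
proof -
  \<comment> \<open>The layers from \<open>k\<close> upwards are those already added; their sum
    stays below \<open>total\<close>, which keeps the accumulator within \<open>B\<close>
    bits.\<close>
  let ?J = "\<lambda>k. St f i0 j0 (DL k) (a + (\<Sum>\<tau>=k..<m. contrib f i0 j0 \<tau>)) b"
  have "hoare (?J m) (layers f) ((n + 1) * ((K_layer + U) + 3 * U)) (?J 0)"
    unfolding layers_def
  proof (rule hoare_loop)
    fix k assume k: "k < m"
    have Suc: "(\<Sum>\<tau>=k..<m. contrib f i0 j0 \<tau>) = (\<Sum>\<tau>=Suc k..<m. contrib f i0 j0 \<tau>) + contrib f i0 j0 k"
      using k by (simp add: sum.atLeast_Suc_lessThan)
    have "(\<Sum>\<tau>=k..<m. contrib f i0 j0 \<tau>) \<le> total f i0 j0"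
      unfolding total_def by (rule sum_mono2) auto
    then have bound: "a + (\<Sum>\<tau>=Suc k..<m. contrib f i0 j0 \<tau>) + contrib f i0 j0 k \<le> 2 ^ (10 * n + 17)"
      using a Suc by simp
    have acc: "hoare (\<lambda>s. St f i0 j0 (DL k) (a + (\<Sum>\<tau>=Suc k..<m. contrib f i0 j0 \<tau>)) b s \<and> s (av 6) = k)
        (accumulate f) U (\<lambda>s. ?J k s \<and> s (av 6) = k)"
      unfolding Suc add.assoc[symmetric]
      by (rule hoare_accumulate[OF assms(1,2) k _ _ bound]) (use assms k in \<open>auto simp: DL_def\<close>)
    show "hoare (\<lambda>s. ?J (Suc k) s \<and> s (av 6) = k) (Seq (loop 7 NV (loop 8 NV (step f))) (accumulate f))
        (K_layer + U) (\<lambda>s. ?J k s \<and> s (av 6) = k)"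
      by (rule hoare_Seq[OF hoare_layer[OF assms(1,2) k] acc])
  next
    show "m \<le> n" by (rule m)
  next
    fix k s v assume "?J k s"
    then show "?J k (s(av 6 := v))" by (auto intro: St_var)
  qed (auto dest: St_inp simp: MV_def[THEN arg_cong[of _ _ nodes]])
  then show ?thesis by (simp add: K_layers_def total_def lessThan_atLeast0)
qed

text \<open>The state between two starts. Layers below \<open>m\<close> may still hold entries of
  the previous start.\<close>

definition Out :: "bool \<Rightarrow> nat \<Rightarrow> nat \<Rightarrow> memory \<Rightarrow> bool" where
  "Out f a b s \<longleftrightarrow> Base s \<and> (\<forall>i<n. \<forall>j<n. s (tb m i j) = 0) \<and>
     s (av (acc_var f)) = a \<and> s (av (acc_var (\<not> f))) = b"

lemma Out_inp: "Out f a b s \<Longrightarrow> inp s" by (simp add: Out_def Base_def)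

lemma Out_var: "Out f a b s \<Longrightarrow> x < 9 \<Longrightarrow> Out f a b (s(av x := v))"
  by (auto simp: Out_def acc_var_def)

lemma hoare_start:
  assumes ij: "i0 < n" "j0 < n" and a: "a + total f i0 j0 \<le> 2 ^ (10 * n + 17)"
  shows "hoare (\<lambda>s. Out f a b s \<and> s (av 4) = i0 \<and> s (av 5) = j0)
    (Seq (Store (tabA MV (V 4) (V 5)) (Const 1))
       (Seq (layers f) (Store (tabA MV (V 4) (V 5)) (Const 0))))
    (U + (K_layers + U))
    (\<lambda>s. Out f (a + total f i0 j0) b s \<and> s (av 4) = i0 \<and> s (av 5) = j0)"
proof (intro hoare_Seq)
  have small: "x < 2 ^ B" if "x \<le> n" for x using that by (intro lin_less) simp
  note small' = small[of i0] small[of j0] small[of 0] small[of 1]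
  have ok: "ok B (tabA MV (V 4) (V 5)) s \<and> aval (tabA MV (V 4) (V 5)) s = tb m i0 j0"
    if "inp s" "s (av 4) = i0" "s (av 5) = j0" for s
    using that ij small' m by simp
  show "hoare (\<lambda>s. Out f a b s \<and> s (av 4) = i0 \<and> s (av 5) = j0) (Store (tabA MV (V 4) (V 5)) (Const 1)) U
      (St f i0 j0 (DL m) a b)"
  proof (rule hoare_assign)
    fix s assume s: "Out f a b s \<and> s (av 4) = i0 \<and> s (av 5) = j0"
    have "St f i0 j0 (DL m) a b (s(tb m i0 j0 := 1))"
      using s ij acc_var by (auto simp: St_def Out_def DL_def)
    then show "ok B (tabA MV (V 4) (V 5)) s \<and> ok B (Const 1) s \<and>
        St f i0 j0 (DL m) a b (s(aval (tabA MV (V 4) (V 5)) s := aval (Const 1) s))"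
      using ok[of s] s Out_inp small' n_pos by auto
  qed (simp add: nodes_defs)
  show "hoare (St f i0 j0 (DL m) a b) (layers f) K_layers (St f i0 j0 (DL 0) (a + total f i0 j0) b)"
    using ij a by (rule hoare_layers)
  show "hoare (St f i0 j0 (DL 0) (a + total f i0 j0) b) (Store (tabA MV (V 4) (V 5)) (Const 0)) U
      (\<lambda>s. Out f (a + total f i0 j0) b s \<and> s (av 4) = i0 \<and> s (av 5) = j0)"
  proof (rule hoare_assign)
    fix s assume s: "St f i0 j0 (DL 0) (a + total f i0 j0) b s"
    have "Out f (a + total f i0 j0) b (s(tb m i0 j0 := 0))"
      using s ij acc_var by (auto simp: St_def Out_def DL_def)
    then show "ok B (tabA MV (V 4) (V 5)) s \<and> ok B (Const 0) s \<and>
        Out f (a + total f i0 j0) b (s(aval (tabA MV (V 4) (V 5)) s := aval (Const 0) s)) \<and>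
        (s(aval (tabA MV (V 4) (V 5)) s := aval (Const 0) s)) (av 4) = i0 \<and>
        (s(aval (tabA MV (V 4) (V 5)) s := aval (Const 0) s)) (av 5) = j0"
    proof -
      have v: "inp s" "s (av 4) = i0" "s (av 5) = j0" using s St_inp by (auto simp: St_def)
      show ?thesis using ok[OF v] v \<open>Out _ _ _ _\<close> small'(3) by simp
    qed
  qed (simp add: nodes_defs)
qed

text \<open>Five factors of at most \<open>2^n\<close> each: the number of walks, its weight, the
  number of layers, and the numbers of starting states of the two automata.\<close>

lemma grand_le: "grand f \<le> 2 ^ (10 * n + 17)"
proof -
  have "total f i0 j0 \<le> n * (n * 2 ^ n)" for i0 j0
  proof -
    have "total f i0 j0 \<le> m * (n * 2 ^ n)"
      unfolding total_def using sum_bounded_above[of "{..<m}" "contrib f i0 j0"] contrib_le by simp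
    also have "\<dots> \<le> n * (n * 2 ^ n)" using m by simp
    finally show ?thesis .
  qed
  then have "(\<Sum>j0<n. total f i0 j0) \<le> n * (n * (n * 2 ^ n))" for i0
    using sum_bounded_above[of "{..<n}" "total f i0"] by simp
  then have "grand f \<le> n * (n * (n * (n * 2 ^ n)))"
    unfolding grand_def using sum_bounded_above[of "{..<n}" "\<lambda>i0. \<Sum>j0<n. total f i0 j0"] by simp
  also have "\<dots> \<le> 2 ^ n * (2 ^ n * (2 ^ n * (2 ^ n * 2 ^ n)))"
    using n_pow by (intro mult_le_mono) auto
  also have "\<dots> = 2 ^ (5 * n)" by (simp add: power_add[symmetric])
  also have "\<dots> \<le> 2 ^ (10 * n + 17)" by (rule power_increasing) auto
  finally show ?thesis .
qed

lemma hoare_all_starts: "hoare (Out f 0 b) (all_starts f) K_starts (Out f (grand f) b)"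
proof -
  let ?R = "\<lambda>k. \<Sum>i0=k..<n. \<Sum>j0<n. total f i0 j0"
  let ?J = "\<lambda>k. Out f (?R k) b"
  let ?body = "Seq (Store (tabA MV (V 4) (V 5)) (Const 1))
     (Seq (layers f) (Store (tabA MV (V 4) (V 5)) (Const 0)))"
  have "hoare (?J n) (all_starts f) K_starts (?J 0)"
    unfolding all_starts_def K_starts_def
  proof (rule hoare_loop)
    fix i0 assume i0: "i0 < n"
    let ?C = "\<lambda>k. \<Sum>j0=k..<n. total f i0 j0"
    let ?I = "\<lambda>k s. Out f (?R (Suc i0) + ?C k) b s \<and> s (av 4) = i0"
    have R: "?R i0 = ?R (Suc i0) + ?C 0"
      using i0 by (simp add: sum.atLeast_Suc_lessThan lessThan_atLeast0)
    have "?R i0 \<le> grand f" unfolding grand_def by (rule sum_mono2) auto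
    then have le: "?R (Suc i0) + ?C 0 \<le> 2 ^ (10 * n + 17)" using R grand_le[of f] by linarith
    have "hoare (?I n) (loop 5 NV ?body) ((n + 1) * ((U + (K_layers + U)) + 3 * U)) (?I 0)"
    proof (rule hoare_loop)
      fix j0 assume j0: "j0 < n"
      have C: "?C j0 = ?C (Suc j0) + total f i0 j0"
        using j0 by (simp add: sum.atLeast_Suc_lessThan)
      have "?C j0 \<le> ?C 0" by (rule sum_mono2) auto
      then have "?R (Suc i0) + ?C (Suc j0) + total f i0 j0 \<le> 2 ^ (10 * n + 17)" using C le by linarith
      from hoare_start[OF i0 j0 this, of b]
      show "hoare (\<lambda>s. ?I (Suc j0) s \<and> s (av 5) = j0) ?body (U + (K_layers + U))
          (\<lambda>s. ?I j0 s \<and> s (av 5) = j0)"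
        unfolding C by (simp only: conj_assoc add.assoc)
    next
      fix k s v assume "?I k s"
      then show "?I k (s(av 5 := v))" by (auto intro: Out_var)
    qed (auto dest: Out_inp simp: NV_def[THEN arg_cong[of _ _ nodes]])
    then show "hoare (\<lambda>s. ?J (Suc i0) s \<and> s (av 4) = i0) (loop 5 NV ?body)
        ((n + 1) * ((U + (K_layers + U)) + 3 * U)) (\<lambda>s. ?J i0 s \<and> s (av 4) = i0)"
      unfolding R by simp
  next
    fix k s v assume "?J k s"
    then show "?J k (s(av 4 := v))" by (auto intro: Out_var)
  qed (auto dest: Out_inp simp: NV_def[THEN arg_cong[of _ _ nodes]])
  then show ?thesis by (simp add: grand_def lessThan_atLeast0)
qed

text \<open>Burnside's sum grouped by the value of the gcd.\<close>

lemma grand_eq: "grand f = (\<Sum>k=1..m. closed_walks f w (gcd k m))"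
proof -
  have "grand f = (\<Sum>i0<n. \<Sum>j0<n. \<Sum>t=1..m. \<phi> t * walks f w i0 j0 t i0 j0)"
  proof -
    have "total f i0 j0 = (\<Sum>t=1..m. \<phi> t * walks f w i0 j0 t i0 j0)" for i0 j0
      unfolding total_def contrib_def
      by (rule sum.reindex_bij_witness[of _ "\<lambda>t. m - t" "\<lambda>\<tau>. m - \<tau>"]; simp; linarith?)
    then show ?thesis by (simp add: grand_def)
  qed
  also have "\<dots> = (\<Sum>i0<n. \<Sum>t=1..m. \<Sum>j0<n. \<phi> t * walks f w i0 j0 t i0 j0)"
    by (rule sum.cong[OF refl sum.swap])
  also have "\<dots> = (\<Sum>t=1..m. \<Sum>i0<n. \<Sum>j0<n. \<phi> t * walks f w i0 j0 t i0 j0)"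
    by (rule sum.swap)
  also have "\<dots> = (\<Sum>t=1..m. \<phi> t * closed_walks f w t)"
    by (simp only: closed_walks_def n_def sum_distrib_left)
  also have "\<dots> = (\<Sum>t=1..m. \<Sum>k\<in>{k \<in> {1..m}. gcd k m = t}. closed_walks f w (gcd k m))"
    by (simp add: \<phi>_def)
  also have "\<dots> = (\<Sum>k=1..m. closed_walks f w (gcd k m))"
  proof (rule sum.group)
    show "(\<lambda>k. gcd k m) ` {1..m} \<subseteq> {1..m}" using m by (auto simp: Suc_le_eq intro!: dvd_imp_le)
  qed auto
  finally show ?thesis .
qed

end

section \<open>The ranking program\<close>

definition gcd_body where
  "gcd_body = Seq (Store (var 3) (Op Sub (V 1) (Op Mult (Op Div (V 1) (V 2)) (V 2))))
     (Seq (Store (var 1) (V 2)) (Store (var 2) (V 3)))"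
text \<open>The counter takes the values \<open>m - 1, ..., 0\<close>; the index of Burnside's sum
  is the counter plus 1.\<close>

definition count_gcds where
  "count_gcds = loop 0 MV
     (Seq (Store (var 1) (Op Add (V 0) (Const 1)))
       (Seq (Store (var 2) MV)
         (Seq (WhileNZ (V 2) gcd_body)
           (Store (tabA (V 1) NV (Const 0)) (Op Add (Tab (V 1) NV (Const 0)) (Const 1))))))"
definition rank_program where
  "rank_program = Seq count_gcds (Seq (all_starts False) (Seq (all_starts True)
     (Store (Const 0) (Op Div (Op Sub (V 9) (V 10)) MV))))"

context ranking
begin

text \<open>With \<open>k\<close> rounds left exactly the indices above \<open>k\<close> have been
  counted.\<close>

definition Pre :: "nat \<Rightarrow> memory \<Rightarrow> bool" where
  "Pre k s \<longleftrightarrow> inp s \<and> (\<forall>t\<le>m. s (tb t n 0) = card {q \<in> {Suc k..m}. gcd q m = t}) \<and>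
     (\<forall>t\<le>m. \<forall>i<n. \<forall>j\<le>n. s (tb t i j) = 0) \<and> s (av 9) = 0 \<and> s (av 10) = 0"

lemma Pre_inp: "Pre k s \<Longrightarrow> inp s" by (simp add: Pre_def)

lemma Pre_var [simp]: "x < 9 \<Longrightarrow> Pre k (s(av x := v)) = Pre k s"
  by (simp add: Pre_def)

text \<open>Euclid's algorithm with the second argument as variant. The resulting linear bound on
  the rounds is negligible beside the cost of the tables.\<close>

lemma hoare_gcd:
  "hoare (\<lambda>s. Pre k s \<and> s (av 0) = q \<and> gcd (s (av 1)) (s (av 2)) = g \<and> s (av 1) \<le> n \<and> s (av 2) \<le> n)
    (WhileNZ (V 2) gcd_body) (n * ((U + (U + U)) + U) + U)
    (\<lambda>s. Pre k s \<and> s (av 0) = q \<and> s (av 1) = g)"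
proof -
  let ?I = "\<lambda>s. Pre k s \<and> s (av 0) = q \<and> gcd (s (av 1)) (s (av 2)) = g \<and> s (av 1) \<le> n \<and> s (av 2) \<le> n"
  have small: "x < 2 ^ B" if "x \<le> n" for x using that by (intro lin_less) simp
  have "hoare (\<lambda>s. ?I s \<and> aval (V 2) s \<le> n) (WhileNZ (V 2) gcd_body)
      (n * ((U + (U + U)) + 1000 * B) + 1000 * B) (\<lambda>s. ?I s \<and> aval (V 2) s = 0)"
  proof (rule hoare_While)
    fix r assume r: "0 < r" "r \<le> n"
    let ?mod = "Op Sub (V 1) (Op Mult (Op Div (V 1) (V 2)) (V 2))"
    show "hoare (\<lambda>s. ?I s \<and> aval (V 2) s = r) gcd_body (U + (U + U)) (\<lambda>s. ?I s \<and> aval (V 2) s < r)"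
      unfolding gcd_body_def
    proof (intro hoare_Seq)
      show "hoare (\<lambda>s. ?I s \<and> aval (V 2) s = r) (Store (var 3) ?mod) U
          (\<lambda>s. Pre k s \<and> s (av 0) = q \<and> s (av 2) = r \<and> gcd r (s (av 3)) = g \<and> s (av 3) < r)"
      proof (rule hoare_assign)
        fix s assume s: "?I s \<and> aval (V 2) s = r"
        then have inp: "inp s" using Pre_inp by blast
        then have v: "s (av 2) = r" "s (av 1) \<le> n" using s by auto
        have "s (av 1) div r * r \<le> n" "s (av 1) div r \<le> n" "s (av 1) - s (av 1) div r * r \<le> n"
          using v(2) le_trans[OF div_times_less_eq_dividend] le_trans[OF div_le_dividend] by auto
        then have "ok B ?mod s" using inp v small r by simp
        moreover have "aval ?mod s = s (av 1) mod r" using inp v by (simp add: minus_div_mult_eq_mod)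
        moreover have "gcd r (s (av 1) mod r) = g" using s v r gcd_non_0_nat[of r "s (av 1)"] by auto
        ultimately show "ok B (var 3) s \<and> ok B ?mod s \<and>
            (Pre k (s(aval (var 3) s := aval ?mod s)) \<and> (s(aval (var 3) s := aval ?mod s)) (av 0) = q \<and>
             (s(aval (var 3) s := aval ?mod s)) (av 2) = r \<and>
             gcd r ((s(aval (var 3) s := aval ?mod s)) (av 3)) = g \<and>
             (s(aval (var 3) s := aval ?mod s)) (av 3) < r)"
          using inp v s r by simp
      qed (simp add: nodes_defs)
      show "hoare (\<lambda>s. Pre k s \<and> s (av 0) = q \<and> s (av 2) = r \<and> gcd r (s (av 3)) = g \<and> s (av 3) < r)
          (Store (var 1) (V 2)) U
          (\<lambda>s. Pre k s \<and> s (av 0) = q \<and> s (av 1) = r \<and> gcd r (s (av 3)) = g \<and> s (av 3) < r)"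
      proof (rule hoare_assign)
        fix s assume s: "Pre k s \<and> s (av 0) = q \<and> s (av 2) = r \<and> gcd r (s (av 3)) = g \<and> s (av 3) < r"
        then have inp: "inp s" using Pre_inp by blast
        then show "ok B (var 1) s \<and> ok B (V 2) s \<and> Pre k (s(aval (var 1) s := aval (V 2) s)) \<and>
            (s(aval (var 1) s := aval (V 2) s)) (av 0) = q \<and>
            (s(aval (var 1) s := aval (V 2) s)) (av 1) = r \<and>
            gcd r ((s(aval (var 1) s := aval (V 2) s)) (av 3)) = g \<and>
            (s(aval (var 1) s := aval (V 2) s)) (av 3) < r"
          using s r small by simp
      qed (simp add: nodes_defs)
      show "hoare (\<lambda>s. Pre k s \<and> s (av 0) = q \<and> s (av 1) = r \<and> gcd r (s (av 3)) = g \<and> s (av 3) < r)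
          (Store (var 2) (V 3)) U (\<lambda>s. ?I s \<and> aval (V 2) s < r)"
      proof (rule hoare_assign)
        fix s assume s: "Pre k s \<and> s (av 0) = q \<and> s (av 1) = r \<and> gcd r (s (av 3)) = g \<and> s (av 3) < r"
        then have inp: "inp s" using Pre_inp by blast
        have "s (av 3) \<le> n" using s r by simp
        then show "ok B (var 2) s \<and> ok B (V 3) s \<and>
            (?I (s(aval (var 2) s := aval (V 3) s)) \<and> aval (V 2) (s(aval (var 2) s := aval (V 3) s)) < r)"
          using s inp r small by simp
      qed (simp add: nodes_defs)
    qed
  next
    fix s assume "?I s"
    then show "ok B (V 2) s" using Pre_inp[of k s] small by simp
  qed (use B1 in \<open>simp_all add: nodes_defs\<close>)
  then show ?thesis
  proof (rule hoare_conseq)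
    fix s assume s: "?I s"
    then show "?I s \<and> aval (V 2) s \<le> n" using Pre_inp[of k s] by simp
  next
    fix s assume s: "?I s \<and> aval (V 2) s = 0"
    then have "inp s" using Pre_inp by blast
    then show "Pre k s \<and> s (av 0) = q \<and> s (av 1) = g" using s by auto
  qed (simp add: U_def)
qed

definition K_gcds where
  "K_gcds = (n + 1) * ((U + (U + ((n * ((U + (U + U)) + U) + U) + U))) + 3 * U)"

lemma hoare_count_gcds: "hoare (Pre m) count_gcds K_gcds (Pre 0)"
  unfolding count_gcds_def K_gcds_def
proof (rule hoare_loop)
  fix k assume k: "k < m"
  have small: "x < 2 ^ B" if "x \<le> n + 1" for x using that by (intro lin_less) simp
  let ?g = "gcd (Suc k) m"
  show "hoare (\<lambda>s. Pre (Suc k) s \<and> s (av 0) = k)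
    (Seq (Store (var 1) (Op Add (V 0) (Const 1)))
       (Seq (Store (var 2) MV)
         (Seq (WhileNZ (V 2) gcd_body)
           (Store (tabA (V 1) NV (Const 0)) (Op Add (Tab (V 1) NV (Const 0)) (Const 1))))))
    (U + (U + ((n * ((U + (U + U)) + U) + U) + U))) (\<lambda>s. Pre k s \<and> s (av 0) = k)"
  proof (intro hoare_Seq)
    show "hoare (\<lambda>s. Pre (Suc k) s \<and> s (av 0) = k) (Store (var 1) (Op Add (V 0) (Const 1))) U
        (\<lambda>s. Pre (Suc k) s \<and> s (av 0) = k \<and> s (av 1) = Suc k)"
    proof (rule hoare_assign)
      fix s assume s: "Pre (Suc k) s \<and> s (av 0) = k"
      then have inp: "inp s" using Pre_inp by blast
      then show "ok B (var 1) s \<and> ok B (Op Add (V 0) (Const 1)) s \<and>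
          Pre (Suc k) (s(aval (var 1) s := aval (Op Add (V 0) (Const 1)) s)) \<and>
          (s(aval (var 1) s := aval (Op Add (V 0) (Const 1)) s)) (av 0) = k \<and>
          (s(aval (var 1) s := aval (Op Add (V 0) (Const 1)) s)) (av 1) = Suc k"
        using s small[of k] small[of "Suc k"] small[of 1] k m by simp
    qed (simp add: nodes_defs)
    show "hoare (\<lambda>s. Pre (Suc k) s \<and> s (av 0) = k \<and> s (av 1) = Suc k) (Store (var 2) MV) U
        (\<lambda>s. Pre (Suc k) s \<and> s (av 0) = k \<and> gcd (s (av 1)) (s (av 2)) = ?g \<and> s (av 1) \<le> n \<and> s (av 2) \<le> n)"
    proof (rule hoare_assign)
      fix s assume s: "Pre (Suc k) s \<and> s (av 0) = k \<and> s (av 1) = Suc k"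
      then have inp: "inp s" using Pre_inp by blast
      have "Suc k \<le> n" using k m by simp
      then show "ok B (var 2) s \<and> ok B MV s \<and> (Pre (Suc k) (s(aval (var 2) s := aval MV s)) \<and>
          (s(aval (var 2) s := aval MV s)) (av 0) = k \<and>
          gcd ((s(aval (var 2) s := aval MV s)) (av 1)) ((s(aval (var 2) s := aval MV s)) (av 2)) = ?g \<and>
          (s(aval (var 2) s := aval MV s)) (av 1) \<le> n \<and> (s(aval (var 2) s := aval MV s)) (av 2) \<le> n)"
        using s inp m by simp
    qed (simp add: nodes_defs)
    show "hoare (\<lambda>s. Pre (Suc k) s \<and> s (av 0) = k \<and> gcd (s (av 1)) (s (av 2)) = ?g \<and> s (av 1) \<le> n \<and> s (av 2) \<le> n)
        (WhileNZ (V 2) gcd_body) (n * ((U + (U + U)) + U) + U)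
        (\<lambda>s. Pre (Suc k) s \<and> s (av 0) = k \<and> s (av 1) = ?g)"
      by (rule hoare_gcd)
    show "hoare (\<lambda>s. Pre (Suc k) s \<and> s (av 0) = k \<and> s (av 1) = ?g)
        (Store (tabA (V 1) NV (Const 0)) (Op Add (Tab (V 1) NV (Const 0)) (Const 1))) U
        (\<lambda>s. Pre k s \<and> s (av 0) = k)"
    proof (rule hoare_assign)
      fix s assume s: "Pre (Suc k) s \<and> s (av 0) = k \<and> s (av 1) = ?g"
      define C where "C k t = card {q \<in> {Suc k..m}. gcd q m = t}" for k t
      have Pre_C: "Pre k s \<longleftrightarrow> inp s \<and> (\<forall>t\<le>m. s (tb t n 0) = C k t) \<and>
         (\<forall>t\<le>m. \<forall>i<n. \<forall>j\<le>n. s (tb t i j) = 0) \<and> s (av 9) = 0 \<and> s (av 10) = 0" for k s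
        by (simp only: Pre_def C_def)
      have inp: "inp s" and v: "s (av 1) = ?g" using s Pre_inp by auto
      have g: "?g \<le> m" "?g \<le> n" using m by (auto intro: le_trans[OF gcd_le2_nat])
      have sg: "s (tb ?g n 0) = C (Suc k) ?g" using s g by (simp add: Pre_C)
      have c_le: "C (Suc k) ?g \<le> n"
      proof -
        have "C (Suc k) ?g \<le> card {Suc (Suc k)..m}" unfolding C_def by (rule card_mono) auto
        then show ?thesis using m by simp
      qed
      have c: "C k t = C (Suc k) t + of_bool (t = ?g)" for t
      proof -
        have "{Suc k..m} = insert (Suc k) {Suc (Suc k)..m}" using k by auto
        then have "{q \<in> {Suc k..m}. gcd q m = t} =
            (if t = ?g then insert (Suc k) {q \<in> {Suc (Suc k)..m}. gcd q m = t}
             else {q \<in> {Suc (Suc k)..m}. gcd q m = t})" by auto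
        then show ?thesis by (simp add: C_def)
      qed
      have addr: "aval (tabA (V 1) NV (Const 0)) s = tb ?g n 0" using inp v by simp
      have val: "aval (Op Add (Tab (V 1) NV (Const 0)) (Const 1)) s = C (Suc k) ?g + 1"
        using inp v sg by simp
      have "ok B (tabA (V 1) NV (Const 0)) s" using inp v g small[of ?g] small[of 0] by simp
      moreover have "ok B (Op Add (Tab (V 1) NV (Const 0)) (Const 1)) s"
        using inp v g sg c_le small[of ?g] small[of 0] small[of 1] small[of "C (Suc k) ?g"]
          small[of "C (Suc k) ?g + 1"] by simp
      moreover have "Pre k (s(tb ?g n 0 := C (Suc k) ?g + 1))"
        using s by (auto simp: Pre_C c)
      ultimately show "ok B (tabA (V 1) NV (Const 0)) s \<and>
          ok B (Op Add (Tab (V 1) NV (Const 0)) (Const 1)) s \<and>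
          Pre k (s(aval (tabA (V 1) NV (Const 0)) s := aval (Op Add (Tab (V 1) NV (Const 0)) (Const 1)) s)) \<and>
          (s(aval (tabA (V 1) NV (Const 0)) s := aval (Op Add (Tab (V 1) NV (Const 0)) (Const 1)) s)) (av 0) = k"
        unfolding addr val using s by simp
    qed (simp add: nodes_defs)
  qed
next
  fix k s v assume "Pre k s"
  then show "Pre k (s(av 0 := v))" by simp
qed (use m in \<open>auto dest: Pre_inp simp: MV_def[THEN arg_cong[of _ _ nodes]]\<close>)

lemma hoare_rank_program:
  "hoare (Pre m) rank_program (K_gcds + (K_starts + (K_starts + U)))
     (\<lambda>s. s 0 = (grand False - grand True) div m)"
  unfolding rank_program_def
proof (intro hoare_Seq)
  show "hoare (Pre m) count_gcds K_gcds (Pre 0)" by (rule hoare_count_gcds)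
  have Pre: "Out False 0 0 s" if "Pre 0 s" for s
    using that m by (auto simp: Pre_def Out_def Base_def \<phi>_def acc_var_def)
  show "hoare (Pre 0) (all_starts False) K_starts (Out False (grand False) 0)"
    by (rule hoare_conseq[OF hoare_all_starts Pre]) auto
  \<comment> \<open>\<open>Out\<close> names the accumulators relative to the current pass, so its
    two values change places between the passes.\<close>
  have swap: "Out True b a s" if "Out False a b s" for a b s using that by (simp add: Out_def)
  show "hoare (Out False (grand False) 0) (all_starts True) K_starts (Out True (grand True) (grand False))"
    by (rule hoare_conseq[OF hoare_all_starts swap]) auto
  show "hoare (Out True (grand True) (grand False))
      (Store (Const 0) (Op Div (Op Sub (V 9) (V 10)) MV)) U (\<lambda>s. s 0 = (grand False - grand True) div m)"
  proof (rule hoare_assign)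
    fix s assume s: "Out True (grand True) (grand False) s"
    have inp: "inp s" and v: "s (av 9) = grand False" "s (av 10) = grand True"
      using s Out_inp by (auto simp: Out_def acc_var_def)
    have big: "x < 2 ^ B" if "x \<le> grand f" for x f
    proof (rule pow_less)
      have "(2::nat) ^ (10 * n + 17) \<le> 2 ^ (10 * n + 19)" by (rule power_increasing) auto
      then show "x \<le> 2 ^ (10 * n + 19)" using that grand_le[of f] by linarith
    qed
    have "grand False - grand True < 2 ^ B" "(grand False - grand True) div m < 2 ^ B"
      using le_trans[OF div_le_dividend] by (auto intro!: big[of _ False])
    then show "ok B (Const 0) s \<and> ok B (Op Div (Op Sub (V 9) (V 10)) MV) s \<and>
        (s(aval (Const 0) s := aval (Op Div (Op Sub (V 9) (V 10)) MV) s)) 0 = (grand False - grand True) div m"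
      using inp v big[OF order_refl, of False] big[OF order_refl, of True] by simp
  qed (simp add: nodes_defs)
qed

text \<open>Cells beyond the input are 0, which initialises the counts, the table with its failure
  column and both accumulators.\<close>

lemma Pre_input: "Pre m (input w m)"
  unfolding Pre_def inp_def input_def tb_def av_def n_def[symmetric] using m by auto

text \<open>Two factors \<open>p\<close> come from the starts, one from the layers and two from the
  entries of a layer; \<open>U\<close> is the sixth. The constant is
  \<open>11 + 19 + 19 + 1 = 50\<close> times the 20000 bounding \<open>U\<close>.\<close>

lemma cost_bound: "K_gcds + (K_starts + (K_starts + U)) \<le> 1000000 * (n + 1) ^ 6"
proof -
  define p where "p = n + 1"
  have p1: "1 \<le> p" by (simp add: p_def)
  have U: "U \<le> 20000 * p"
  proof -
    have "1000 * B \<le> 20000 * p" by (simp add: B_def p_def)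
    then show ?thesis by (simp only: U_def)
  qed
  have up: "U \<le> p ^ i * U" for i
    using mult_le_mono1[OF one_le_power[OF p1, of i], of U] by simp
  have row: "K_row = 4 * (p * U)" by (simp add: K_row_def p_def)
  have layer: "K_layer \<le> 7 * (p ^ 2 * U)"
  proof -
    have "K_layer = 4 * (p ^ 2 * U) + 3 * (p * U)"
      unfolding K_layer_def row p_def[symmetric] by (simp add: power2_eq_square algebra_simps)
    moreover have "p * U \<le> p ^ 2 * U" using p1 by (simp add: power2_eq_square)
    ultimately show ?thesis by linarith
  qed
  have layers: "K_layers \<le> 11 * (p ^ 3 * U)"
  proof -
    have "K_layers \<le> p * (7 * (p ^ 2 * U) + 4 * (p ^ 2 * U))"
      unfolding K_layers_def p_def[symmetric] using layer up[of 2] by (intro mult_le_mono2) linarith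
    also have "\<dots> = 11 * (p ^ 3 * U)" by (simp add: power3_eq_cube power2_eq_square algebra_simps)
    finally show ?thesis .
  qed
  have starts: "K_starts \<le> 19 * (p ^ 5 * U)"
  proof -
    have "p * ((U + (K_layers + U)) + 3 * U) \<le> p * (16 * (p ^ 3 * U))"
      using layers up[of 3] by (intro mult_le_mono2) linarith
    also have "\<dots> = 16 * (p ^ 4 * U)" by (simp add: power_numeral_reduce)
    finally have "K_starts \<le> p * (19 * (p ^ 4 * U))"
      unfolding K_starts_def p_def[symmetric] using up[of 4] by (intro mult_le_mono2) linarith
    also have "\<dots> = 19 * (p ^ 5 * U)" by (simp add: power_numeral_reduce)
    finally show ?thesis .
  qed
  have gcds: "K_gcds \<le> 11 * (p ^ 5 * U)"
  proof -
    have "n * ((U + (U + U)) + U) \<le> 4 * (p ^ 1 * U)" by (simp add: p_def algebra_simps)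
    then have "(U + (U + ((n * ((U + (U + U)) + U) + U) + U))) + 3 * U \<le> 11 * (p ^ 1 * U)"
      using up[of 1] by linarith
    then have "K_gcds \<le> p * (11 * (p ^ 1 * U))" unfolding K_gcds_def p_def[symmetric] by (rule mult_le_mono2)
    also have "\<dots> = 11 * (p ^ 2 * U)" by (simp add: power2_eq_square)
    also have "\<dots> \<le> 11 * (p ^ 5 * U)"
      using p1 by (intro mult_le_mono order_refl power_increasing) auto
    finally show ?thesis .
  qed
  have "K_gcds + (K_starts + (K_starts + U)) \<le> 50 * (p ^ 5 * U)"
    using gcds starts up[of 5] by linarith
  also have "\<dots> \<le> 50 * (p ^ 5 * (20000 * p))" using U by (intro mult_le_mono2)
  also have "\<dots> = 1000000 * p ^ 6" by (simp add: power_numeral_reduce)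
  finally show ?thesis by (simp only: p_def)
qed

end

text \<open>From 3 on the logarithm is at least 1; the factor \<open>64 = 2^6\<close> comes from
  \<open>n + 1 \<le> 2 * n\<close>.\<close>

lemma time_bigo: "(\<lambda>n. real (1000000 * (n + 1) ^ 6)) \<in> O(\<lambda>n. real n ^ 6 * ln (real n))"
proof (rule bigoI[of _ 64000000], rule eventually_mono[OF eventually_ge_at_top[of 3]])
  fix n :: nat assume n: "3 \<le> n"
  have "real (n + 1) ^ 6 \<le> (2 * real n) ^ 6" using n by (intro power_mono) auto
  then have 1: "real (n + 1) ^ 6 \<le> 64 * real n ^ 6" by (simp add: power_mult_distrib)
  have "exp 1 \<le> real n" using exp_le n by linarith
  then have 2: "1 \<le> ln (real n)" using n by (subst ln_ge_iff) auto
  have "real (1000000 * (n + 1) ^ 6) \<le> 64000000 * (real n ^ 6 * 1)" using 1 by simp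
  also have "\<dots> \<le> 64000000 * (real n ^ 6 * ln (real n))" using 2 by (intro mult_left_mono) auto
  finally show "norm (real (1000000 * (n + 1) ^ 6)) \<le> 64000000 * norm (real n ^ 6 * ln (real n))"
    using 2 by (simp add: abs_mult)
qed

theorem mainTheorem4:
  shows "\<exists>(p :: com) (T :: nat \<Rightarrow> nat).
           (\<lambda>n. real (T n)) \<in> O(\<lambda>n. real n ^ 6 * ln (real n)) \<and>
           computes_within p
             (\<lambda>w m. length w \<ge> 1 \<and> w \<in> canon ` unlabelled_necklaces (length w) \<and>
                    1 \<le> m \<and> m \<le> length w)
             RankEN T"
proof (intro exI conjI)
  show "(\<lambda>n. real (1000000 * (n + 1) ^ 6)) \<in> O(\<lambda>n. real n ^ 6 * ln (real n))" by (rule time_bigo)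
  show "computes_within rank_program
     (\<lambda>w m. length w \<ge> 1 \<and> w \<in> canon ` unlabelled_necklaces (length w) \<and> 1 \<le> m \<and> m \<le> length w)
     RankEN (\<lambda>n. 1000000 * (n + 1) ^ 6)"
    unfolding computes_within_def
  proof (intro allI impI)
    fix w m
    assume wm: "length w \<ge> 1 \<and> w \<in> canon ` unlabelled_necklaces (length w) \<and> 1 \<le> m \<and> m \<le> length w"
    interpret ranking w m "length w" "10 * length w + 20"
      by unfold_locales (use wm in auto)
    have "minimal (seqw w)" using canon_unlabelled_minimal(2) wm by blast
    then have "RankEN w m = (grand False - grand True) div m"
      using RankEN_formula wm by (simp only: grand_eq)
    moreover obtain k s where "exec rank_program (input w m) k s"
        "s 0 = (grand False - grand True) div m" "k \<le> K_gcds + (K_starts + (K_starts + U))"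
      using hoare_rank_program Pre_input unfolding hoare_def by blast
    ultimately show "\<exists>k s. exec rank_program (input w m) k s \<and> s 0 = RankEN w m \<and>
        k \<le> 1000000 * (length w + 1) ^ 6"
      using le_trans[OF _ cost_bound] by auto
  qed
qed

end
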